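(* Let $\alpha\in(0,\infty)^q$. Every $\alpha$-multihomogeneous tail measure $\nu$ on $\mathcal C$ equals $\nu_Z$ for some $\mathcal C_\Pi^\circ$-valued random element $Z$ satisfying $$\mathbb E\Big\{\prod_{i=1}^q\rho_{n_i,i}(Z)^{\alpha_i}\Big\}<\infty,\qquad \boldsymbol n\in\mathbb N^q.\qquad( * )$$ If $\nu$ is carried by a Borel set invariant under componentwise positive scaling, $Z$ can be chosen in that set almost surely. Moreover, for every such representer (that is, every $\mathcal C_\Pi^\circ$-valued $Z$ satisfying $( * )$ with $\nu=\nu_Z$), if $R=(R_1,\dots,R_q)$ is independent of $Z$ with mutually independent coordinates satisfying $\mathbb P\{R_i>x\}=x^{-\alpha_i}$, $x\ge1$, then $X=R\odot Z$ satisfies $$X\in\mathrm{RV}_\Pi(\alpha,\nu_Z)$$ and $$\lim_{u\to\infty}\big\|\mathbb I_A\mu_u^X-\mathbb I_A\nu\big\|_{\mathrm{TV}}=0,\qquad A\in\mathcal B_\Pi.$$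
   Context: Index set and paths. $q\in\mathbb N=\{1,2,\dots\}$; $\mathsf T$ is either a nonempty finite or countably infinite discrete set, or $\mathsf T=\mathbb R^m$ with $m\in\mathbb N$. $\mathcal C=C(\mathsf T,\mathbb R^q)$ is the space of continuous functions $f=(f_1,\dots,f_q)$ with the topology of locally uniform convergence and its Borel $\sigma$-field. $(K_n)_{n\ge1}$ is a fixed increasing exhaustion of $\mathsf T$ by nonempty compact sets such that every compact subset lies in some $K_n$; for $\mathsf T=\mathbb R^m$, $K_n=[-n,n]^m$. Put $\rho_{n,i}(f)=\sup_{t\in K_n}|f_i(t)|$. $G=(0,\infty)^q$; $(r\odot f)(t)=(r_1f_1(t),\dots,r_qf_q(t))$ for $r\in G$; $u^{-1}=(u_1^{-1},\dots,u_q^{-1})$; $\chi_\alpha(r)=\prod_ir_i^{\alpha_i}$; $\vartheta_\alpha(dr)=\prod_{i=1}^q\alpha_ir_i^{-\alpha_i-1}dr_i$ on $G$. $D_\Pi=\bigcup_{i=1}^q\{f\in\mathcal C:f_i\equiv0\}$, $\mathcal C_\Pi^\circ=\mathcal C\setminus D_\Pi$. Product windows: $U_{\boldsymbol n,\varepsilon}=\{f\in\mathcal C:\rho_{n_i,i}(f)>\varepsilon_i,\ 1\le i\le q\}$, $\boldsymbol n\in\mathbb N^q$, $\varepsilon\in G$. $\mathcal B_\Pi$ is the collection of Borel sets $A\subset\mathcal C_\Pi^\circ$ contained in some product window (equivalently, at positive distance from $D_\Pi$ for a translation-invariant metric inducing the topology). A nonzero Borel measure $\nu$ on $\mathcal C$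 is an $\alpha$-multihomogeneous tail measure if $\nu(D_\Pi)=0$; $\nu(U_{\boldsymbol n,\boldsymbol1})<\infty$ for all $\boldsymbol n\in\mathbb N^q$, $\boldsymbol1=(1,\dots,1)$; and $\nu(r\odot A)=\chi_\alpha(r)^{-1}\nu(A)$ for $r\in G$, $A\subset\mathcal C$ Borel. For a $\mathcal C_\Pi^\circ$-valued random element $Z$: $\nu_Z(A)=\mathbb E\{\int_G\mathbb I_{\{r\odot Z\in A\}}\,\vartheta_\alpha(dr)\}$. $\mu_u^X(A)=\chi_\alpha(u)\mathbb P\{u^{-1}\odot X\in A\}$ for Borel $A\subset\mathcal C_\Pi^\circ$, $u\in G$. $u\to\infty$ means $\min_iu_i\to\infty$, with no restriction on relative rates (limits along every such sequence). $X\in\mathrm{RV}_\Pi(\alpha,\nu)$ means $\lim_{u\to\infty}\int F\,d\mu_u^X=\int F\,d\nu$ for every bounded continuous $F:\mathcal C\to\mathbb R$ vanishing outside some product window, with $\nu$ nonzero and finite on every product window. $\mathbb I_A\mu$ is the restriction of $\mu$ to $A$, and for finite measures $\|\mu-\eta\|_{\mathrm{TV}}=\sup\{|\int F\,d\mu-\int F\,d\eta|:F\text{ measurable with values in }[-1,1]\}$. *)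

theory Defs
  imports "HOL-Probability.Probability"
begin

section \<open>The index space and its exhaustion\<close>

text \<open>
  The index set is the type \<open>'t\<close>; \<open>q\<close> is the cardinality of the finite index type \<open>'q\<close>.
  Exhausting sequences are indexed from \<open>n = 1\<close> on; the value \<open>K 0\<close> is never used.
\<close>

definition exhaustion :: "(nat \<Rightarrow> 't::topological_space set) \<Rightarrow> bool" where
  "exhaustion K \<longleftrightarrow>
     (\<forall>n\<ge>1. compact (K n) \<and> K n \<noteq> {} \<and> K n \<subseteq> K (Suc n)) \<and>
     (\<Union>n\<in>{1..}. K n) = UNIV \<and>
     (\<forall>L. compact L \<longrightarrow> (\<exists>n\<ge>1. L \<subseteq> K n))"

definition discrete_index :: "(nat \<Rightarrow> 't::topological_space set) \<Rightarrow> bool" where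
  "discrete_index K \<longleftrightarrow>
     countable (UNIV :: 't set) \<and> (\<forall>S :: 't set. open S) \<and> exhaustion K"

text \<open>
  A type variable cannot be a discrete space and \<open>\<real>\<^sup>m\<close> at the same time, so in the Euclidean case
  \<open>'t\<close> is identified with \<open>\<real>\<^sup>m\<close> by a homeomorphism \<open>\<phi>\<close>; \<open>\<phi> = id\<close> gives \<open>\<real>\<^sup>m\<close> itself with
  \<open>K n = [-n, n]\<^sup>m\<close>.
\<close>

definition euclidean_index ::
    "('t::topological_space \<Rightarrow> real ^ 'm) \<Rightarrow> (nat \<Rightarrow> 't set) \<Rightarrow> bool" where
  "euclidean_index \<phi> K \<longleftrightarrow>
     (\<exists>\<psi>. homeomorphism UNIV UNIV \<phi> \<psi>) \<and>
     (\<forall>n\<ge>1. K n = {t. \<forall>j. - real n \<le> \<phi> t $ j \<and> \<phi> t $ j \<le> real n})"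


section \<open>The path space\<close>

definition paths :: "('t::topological_space \<Rightarrow> real ^ 'q) set" where
  "paths = {f. continuous_on UNIV f}"

text \<open>
  On the locally compact index spaces considered here, locally uniform convergence is uniform
  convergence on compact sets.
\<close>

definition path_topology :: "('t::topological_space \<Rightarrow> real ^ 'q) topology" where
  "path_topology = topology (\<lambda>U. U \<subseteq> paths \<and>
     (\<forall>f\<in>U. \<exists>L e. compact L \<and> e > 0 \<and>
        {g \<in> paths. \<forall>t\<in>L. dist (g t) (f t) < e} \<subseteq> U))"

lemma openin_path_topology:
  fixes U :: "('t::topological_space \<Rightarrow> real ^ 'q) set"
  shows "openin path_topology U \<longleftrightarrow> U \<subseteq> paths \<and>
     (\<forall>f\<in>U. \<exists>L e. compact L \<and> e > 0 \<and>
        {g \<in> paths. \<forall>t\<in>L. dist (g t) (f t) < e} \<subseteq> U)"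
proof -
  let ?N = "\<lambda>(f :: 't \<Rightarrow> real ^ 'q) L e. {g \<in> paths. \<forall>t\<in>L. dist (g t) (f t) < e}"
  have "istopology (\<lambda>U :: ('t \<Rightarrow> real ^ 'q) set. U \<subseteq> paths \<and>
     (\<forall>f\<in>U. \<exists>L e. compact L \<and> e > 0 \<and> ?N f L e \<subseteq> U))"
    unfolding istopology_def
  proof (intro conjI allI impI ballI)
    fix S T :: "('t \<Rightarrow> real ^ 'q) set"
    assume "S \<subseteq> paths \<and> (\<forall>f\<in>S. \<exists>L e. compact L \<and> e > 0 \<and> ?N f L e \<subseteq> S)"
    then show "S \<inter> T \<subseteq> paths" by auto
  next
    fix S T :: "('t \<Rightarrow> real ^ 'q) set" and f
    assume S: "S \<subseteq> paths \<and> (\<forall>f\<in>S. \<exists>L e. compact L \<and> e > 0 \<and> ?N f L e \<subseteq> S)"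
      and T: "T \<subseteq> paths \<and> (\<forall>f\<in>T. \<exists>L e. compact L \<and> e > 0 \<and> ?N f L e \<subseteq> T)"
      and f: "f \<in> S \<inter> T"
    obtain L e where L: "compact L" "e > 0" "?N f L e \<subseteq> S"
      using S IntD1[OF f] by meson
    obtain L' e' where L': "compact L'" "e' > 0" "?N f L' e' \<subseteq> T"
      using T IntD2[OF f] by meson
    have "?N f (L \<union> L') (min e e') \<subseteq> ?N f L e" "?N f (L \<union> L') (min e e') \<subseteq> ?N f L' e'"
      by auto
    then have "?N f (L \<union> L') (min e e') \<subseteq> S \<inter> T"
      using L(3) L'(3) by (meson Int_greatest order_trans)
    moreover have "compact (L \<union> L')" "min e e' > 0" using L L' by auto
    ultimately show "\<exists>L e. compact L \<and> e > 0 \<and> ?N f L e \<subseteq> S \<inter> T"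
      by (intro exI conjI)
  next
    fix \<K> :: "('t \<Rightarrow> real ^ 'q) set set"
    assume "\<forall>U\<in>\<K>. U \<subseteq> paths \<and> (\<forall>f\<in>U. \<exists>L e. compact L \<and> e > 0 \<and> ?N f L e \<subseteq> U)"
    then show "\<Union>\<K> \<subseteq> paths" by (intro Union_least) simp
  next
    fix \<K> :: "('t \<Rightarrow> real ^ 'q) set set" and f
    assume *: "\<forall>U\<in>\<K>. U \<subseteq> paths \<and> (\<forall>f\<in>U. \<exists>L e. compact L \<and> e > 0 \<and> ?N f L e \<subseteq> U)"
      and "f \<in> \<Union>\<K>"
    then obtain U where U: "U \<in> \<K>" "f \<in> U" by (elim UnionE)
    then obtain L e where L: "compact L" "e > 0" "?N f L e \<subseteq> U" using * by meson
    have "?N f L e \<subseteq> \<Union>\<K>" using L(3) Union_upper[OF U(1)] by (rule order_trans)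
    then show "\<exists>L e. compact L \<and> e > 0 \<and> ?N f L e \<subseteq> \<Union>\<K>"
      using L(1,2) by (intro exI conjI)
  qed
  then show ?thesis by (simp only: path_topology_def topology_inverse')
qed

lemma topspace_path_topology:
  "topspace path_topology = (paths :: ('t::topological_space \<Rightarrow> real ^ 'q) set)"
proof
  show "topspace path_topology \<subseteq> paths"
    using openin_path_topology[THEN iffD1, OF openin_topspace] by (rule conjunct1)
  have "openin path_topology paths"
    unfolding openin_path_topology
    by (intro conjI ballI exI[of _ "{}"] exI[of _ "1::real"]) auto
  then show "paths \<subseteq> topspace path_topology" by (rule openin_subset)
qed

definition path_borel :: "('t::topological_space \<Rightarrow> real ^ 'q) measure" where
  "path_borel = sigma paths {U. openin path_topology U}"

definition rho ::
    "(nat \<Rightarrow> 't set) \<Rightarrow> nat \<Rightarrow> 'q \<Rightarrow> ('t \<Rightarrow> real ^ 'q) \<Rightarrow> real" where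
  "rho K n i f = (SUP t\<in>K n. \<bar>f t $ i\<bar>)"

definition D_Pi :: "('t::topological_space \<Rightarrow> real ^ 'q) set" where
  "D_Pi = {f \<in> paths. \<exists>i. \<forall>t. f t $ i = 0}"

definition paths0 :: "('t::topological_space \<Rightarrow> real ^ 'q) set" where
  "paths0 = paths - D_Pi"

abbreviation path0_borel :: "('t::topological_space \<Rightarrow> real ^ 'q) measure" where
  "path0_borel \<equiv> restrict_space path_borel paths0"


section \<open>Componentwise scaling and product windows\<close>

definition pos_orthant :: "(real ^ 'q) set" where
  "pos_orthant = {r. \<forall>i. 0 < r $ i}"

definition pos_indices :: "('q \<Rightarrow> nat) set" where
  "pos_indices = {n. \<forall>i. 1 \<le> n i}"

definition odot :: "real ^ 'q \<Rightarrow> ('t \<Rightarrow> real ^ 'q) \<Rightarrow> 't \<Rightarrow> real ^ 'q"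
    (infixr \<open>\<odot>\<close> 75) where
  "r \<odot> f = (\<lambda>t. \<chi> i. r $ i * f t $ i)"

definition vec_inverse :: "real ^ 'q \<Rightarrow> real ^ 'q" where
  "vec_inverse u = (\<chi> i. inverse (u $ i))"

definition chi_pow :: "real ^ 'q::finite \<Rightarrow> real ^ 'q \<Rightarrow> real" where
  "chi_pow \<alpha> r = (\<Prod>i\<in>UNIV. r $ i powr \<alpha> $ i)"

text \<open>The measure \<open>\<vartheta>\<^sub>\<alpha>\<close>, extended by zero from the open positive orthant to \<open>\<real>\<^sup>q\<close>.\<close>

definition theta :: "real ^ 'q::finite \<Rightarrow> (real ^ 'q) measure" where
  "theta \<alpha> = density lborel (\<lambda>r. if r \<in> pos_orthant
     then ennreal (\<Prod>i\<in>UNIV. \<alpha> $ i * r $ i powr (- \<alpha> $ i - 1)) else 0)"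

definition window ::
    "(nat \<Rightarrow> 't::topological_space set) \<Rightarrow> ('q \<Rightarrow> nat) \<Rightarrow> real ^ 'q \<Rightarrow> ('t \<Rightarrow> real ^ 'q) set" where
  "window K n \<epsilon> = {f \<in> paths. \<forall>i. rho K (n i) i f > \<epsilon> $ i}"

definition B_Pi ::
    "(nat \<Rightarrow> 't::topological_space set) \<Rightarrow> ('t \<Rightarrow> real ^ 'q) set set" where
  "B_Pi K = {A \<in> sets path_borel. A \<subseteq> paths0 \<and>
     (\<exists>n\<in>pos_indices. \<exists>\<epsilon>\<in>pos_orthant. A \<subseteq> window K n \<epsilon>)}"


section \<open>Multihomogeneous tail measures and their representers\<close>

definition multihomogeneous_tail_measure ::
    "(nat \<Rightarrow> 't::topological_space set) \<Rightarrow> real ^ 'q::finite \<Rightarrow>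
     ('t \<Rightarrow> real ^ 'q) measure \<Rightarrow> bool" where
  "multihomogeneous_tail_measure K \<alpha> \<nu> \<longleftrightarrow>
     sets \<nu> = sets path_borel \<and>
     emeasure \<nu> (space \<nu>) \<noteq> 0 \<and>
     emeasure \<nu> D_Pi = 0 \<and>
     (\<forall>n\<in>pos_indices. emeasure \<nu> (window K n 1) < \<infinity>) \<and>
     (\<forall>r\<in>pos_orthant. \<forall>A\<in>sets path_borel.
        emeasure \<nu> ((\<lambda>f. r \<odot> f) ` A) = ennreal (inverse (chi_pow \<alpha> r)) * emeasure \<nu> A)"

definition nu_of ::
    "real ^ 'q::finite \<Rightarrow> 'w measure \<Rightarrow> ('w \<Rightarrow> 't::topological_space \<Rightarrow> real ^ 'q) \<Rightarrow>
     ('t \<Rightarrow> real ^ 'q) measure" where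
  "nu_of \<alpha> M Z = measure_of paths (sets path_borel)
     (\<lambda>A. \<integral>\<^sup>+ \<omega>. (\<integral>\<^sup>+ r. indicator A (r \<odot> Z \<omega>) \<partial>theta \<alpha>) \<partial>M)"

definition representer ::
    "(nat \<Rightarrow> 't::topological_space set) \<Rightarrow> real ^ 'q::finite \<Rightarrow> ('t \<Rightarrow> real ^ 'q) measure \<Rightarrow>
     'w measure \<Rightarrow> ('w \<Rightarrow> 't \<Rightarrow> real ^ 'q) \<Rightarrow> bool" where
  "representer K \<alpha> \<nu> M Z \<longleftrightarrow>
     prob_space M \<and>
     Z \<in> measurable M path0_borel \<and>
     (\<forall>n\<in>pos_indices.
        (\<integral>\<^sup>+ \<omega>. ennreal (\<Prod>i\<in>UNIV. rho K (n i) i (Z \<omega>) powr \<alpha> $ i) \<partial>M) < \<infinity>) \<and>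
     \<nu> = nu_of \<alpha> M Z"

text \<open>
  \<open>R\<close> is independent of \<open>Z\<close> and has independent Pareto coordinates. Independence of the pair is
  stated through the generated \<open>\<sigma>\<close>-fields because \<open>indep_var\<close> needs a common value type.
\<close>

definition independent_pareto ::
    "real ^ 'q::finite \<Rightarrow> 'w measure \<Rightarrow> ('w \<Rightarrow> real ^ 'q) \<Rightarrow>
     ('w \<Rightarrow> 't::topological_space \<Rightarrow> real ^ 'q) \<Rightarrow> bool" where
  "independent_pareto \<alpha> M R Z \<longleftrightarrow>
     R \<in> measurable M borel \<and>
     prob_space.indep_set M
       {R -` B \<inter> space M |B. B \<in> sets borel}
       {Z -` A \<inter> space M |A. A \<in> sets path0_borel} \<and>
     prob_space.indep_vars M (\<lambda>_. borel) (\<lambda>i \<omega>. R \<omega> $ i) UNIV \<and>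
     (\<forall>i. \<forall>x\<ge>1. measure M {\<omega> \<in> space M. R \<omega> $ i > x} = x powr (- \<alpha> $ i))"


section \<open>Regular variation\<close>

text \<open>The filter expressing \<open>min\<^sub>i u\<^sub>i \<rightarrow> \<infinity>\<close>, without restriction on the relative rates.\<close>

definition all_at_top :: "(real ^ 'q::finite) filter" where
  "all_at_top = filtercomap (\<lambda>u. Min (range (\<lambda>i. u $ i))) at_top"

definition mu ::
    "real ^ 'q::finite \<Rightarrow> 'w measure \<Rightarrow> ('w \<Rightarrow> 't::topological_space \<Rightarrow> real ^ 'q) \<Rightarrow>
     real ^ 'q \<Rightarrow> ('t \<Rightarrow> real ^ 'q) measure" where
  "mu \<alpha> M X u = restrict_space
     (scale_measure (ennreal (chi_pow \<alpha> u))
        (distr M path_borel (\<lambda>\<omega>. vec_inverse u \<odot> X \<omega>))) paths0"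

definition RV_Pi ::
    "(nat \<Rightarrow> 't::topological_space set) \<Rightarrow> real ^ 'q::finite \<Rightarrow> ('t \<Rightarrow> real ^ 'q) measure \<Rightarrow>
     'w measure \<Rightarrow> ('w \<Rightarrow> 't \<Rightarrow> real ^ 'q) \<Rightarrow> bool" where
  "RV_Pi K \<alpha> \<nu> M X \<longleftrightarrow>
     X \<in> measurable M path_borel \<and>
     sets \<nu> = sets path_borel \<and>
     emeasure \<nu> (space \<nu>) \<noteq> 0 \<and>
     (\<forall>n\<in>pos_indices. \<forall>\<epsilon>\<in>pos_orthant. emeasure \<nu> (window K n \<epsilon>) < \<infinity>) \<and>
     (\<forall>F :: ('t \<Rightarrow> real ^ 'q) \<Rightarrow> real.
        continuous_map path_topology euclideanreal F \<longrightarrow>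
        bounded (F ` paths) \<longrightarrow>
        (\<exists>n\<in>pos_indices. \<exists>\<epsilon>\<in>pos_orthant. \<forall>f\<in>paths - window K n \<epsilon>. F f = 0) \<longrightarrow>
        ((\<lambda>u. integral\<^sup>L (mu \<alpha> M X u) F) \<longlongrightarrow> integral\<^sup>L \<nu> F) all_at_top)"

text \<open>Intended for finite measures with the same \<open>\<sigma>\<close>-field.\<close>

definition tv_dist :: "'a measure \<Rightarrow> 'a measure \<Rightarrow> real" where
  "tv_dist \<mu> \<eta> =
     (SUP F \<in> {F \<in> borel_measurable \<mu>. \<forall>x\<in>space \<mu>. F x \<in> {-1..1}}.
        \<bar>integral\<^sup>L \<mu> F - integral\<^sup>L \<eta> F\<bar>)"

end

theory Submission
  imports Defs
begin

text \<open>
  On \<open>\<C>\<^sub>\<Pi>\<^sup>\<circ>\<close> let \<open>\<ell>\<^sub>i(f)\<close> be the sup-norm of the \<open>i\<close>-th coordinate over the first compact set of the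
  exhaustion on which no coordinate vanishes. The choice of this set is invariant under scaling, so
  \<open>\<ell>\<^sub>i(r \<odot> f) = r\<^sub>i \<ell>\<^sub>i(f)\<close>. Fubini and homogeneity give
  \<open>\<nu>(A) = \<integral> w(f) \<integral> 1\<^sub>A(s \<odot> f) \<theta>(ds) \<nu>(df)\<close> with \<open>w = \<Prod>\<^sub>i \<ell>\<^sub>i powr -\<alpha>\<^sub>i\<close> on \<open>{\<ell>\<^sub>i > 1 for all i}\<close>
  and \<open>w = 0\<close> elsewhere. The law of \<open>Z\<close> is obtained from \<open>w \<nu>\<close> by rescaling within orbits to a
  probability measure. The moment condition is automatic, because the moment is the mass that
  \<open>\<nu>\<close> gives to a product window.

  For the converse part, the Pareto law is \<open>\<theta>\<close> restricted to \<open>{r\<^sub>i > 1 for all i}\<close>, so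
  homogeneity of \<open>\<theta>\<close> makes \<open>\<mu>\<^sub>u\<close> the image of \<open>P \<otimes> \<theta>\<close> restricted to \<open>{s\<^sub>i > 1/u\<^sub>i for all i}\<close>
  under \<open>(\<omega>, s) \<mapsto> s \<odot> Z(\<omega>)\<close>. Hence \<open>\<mu>\<^sub>u \<le> \<nu>\<close>, and on a set of finite \<open>\<nu>\<close>-measure the total
  variation distance is at most the difference of the masses, which tends to zero.
\<close>

section \<open>Measurability on the path space\<close>

text \<open>The homeomorphism makes the levels images of compact cubes, and a compact set has
  bounded image, so it lies in some cube. Both kinds of index space enter the later arguments only
  through \<open>exhaustion\<close>.\<close>

lemma exhaustion_euclidean_index:
  fixes \<phi> :: "'t::topological_space \<Rightarrow> real ^ 'm"
  assumes "euclidean_index \<phi> K"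
  shows "exhaustion K"
proof -
  obtain \<psi> where h: "homeomorphism UNIV UNIV \<phi> \<psi>"
    and K: "\<And>n. n \<ge> 1 \<Longrightarrow> K n = {t. \<forall>j. - real n \<le> \<phi> t $ j \<and> \<phi> t $ j \<le> real n}"
    using assms unfolding euclidean_index_def by blast
  have inv: "\<phi> (\<psi> y) = y" "\<psi> (\<phi> t) = t" for y t
    using h by (auto simp: homeomorphism_def)
  have cont: "continuous_on S \<phi>" "continuous_on S' \<psi>" for S S'
    using h by (auto simp: homeomorphism_def intro: continuous_on_subset)
  have K_cube: "K n = \<psi> ` cbox (\<chi> j. - real n) (\<chi> j. real n)" if "n \<ge> 1" for n
    unfolding K[OF that] by (auto simp: mem_box_cart inv image_iff intro!: bexI[of _ "\<phi> _"])
  have covered: "\<exists>n\<ge>1. L \<subseteq> K n" if "compact L" for L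
  proof -
    have "bounded (\<phi> ` L)"
      by (intro compact_imp_bounded compact_continuous_image cont that)
    then obtain b where b: "\<And>t. t \<in> L \<Longrightarrow> norm (\<phi> t) \<le> b" by (auto simp: bounded_iff)
    define n where "n = max 1 (nat \<lceil>b\<rceil>)"
    have n: "b \<le> real n" "1 \<le> n" unfolding n_def by linarith+
    have "t \<in> K n" if "t \<in> L" for t
    proof -
      have "\<bar>\<phi> t $ j\<bar> \<le> real n" for j
        using component_le_norm_cart[of "\<phi> t" j] b[OF that] n by linarith
      then show ?thesis unfolding K[OF n(2)] by (auto simp: abs_le_iff minus_le_iff)
    qed
    with n show ?thesis by blast
  qed
  have "compact (K n) \<and> K n \<noteq> {} \<and> K n \<subseteq> K (Suc n)" if n: "n \<ge> 1" for n
  proof (intro conjI)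
    show "compact (K n)"
      unfolding K_cube[OF n] by (intro compact_continuous_image cont compact_cbox)
    have "0 \<in> cbox (\<chi> j. - real n) (\<chi> j. real n :: real ^ 'm)" by (simp add: mem_box_cart)
    then show "K n \<noteq> {}" unfolding K_cube[OF n] by blast
    show "K n \<subseteq> K (Suc n)"
    proof
      fix t assume t: "t \<in> K n"
      have "- real (Suc n) \<le> \<phi> t $ j \<and> \<phi> t $ j \<le> real (Suc n)" for j
        using t n by (simp add: K) (smt (verit))
      then show "t \<in> K (Suc n)" by (simp add: K)
    qed
  qed
  moreover have "(\<Union>n\<in>{1..}. K n) = UNIV"
    using covered[OF compact_sing] by auto
  ultimately show ?thesis using covered unfolding exhaustion_def by blast
qed

section \<open>Borel sets of the path space and joint continuity of scaling\<close>

lemma space_path_borel [simp]: "space path_borel = paths"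
  unfolding path_borel_def using openin_path_topology
  by (intro space_measure_of) blast

lemma sets_path_borel:
  "sets path_borel = sigma_sets paths {U. openin path_topology U}"
  unfolding path_borel_def using openin_path_topology
  by (intro sets_measure_of) blast

lemma openin_path_borel: "openin path_topology U \<Longrightarrow> U \<in> sets path_borel"
  unfolding sets_path_borel by (rule sigma_sets.Basic) simp

lemma paths_component: "f \<in> paths \<Longrightarrow> continuous_on S (\<lambda>t. f t $ i)"
  unfolding paths_def by (auto intro!: continuous_intros intro: continuous_on_subset)

text \<open>The distance to the centre attains its maximum on a nonempty compact set, which leaves a
  positive slack below e around every member.\<close>

lemma openin_path_ball:
  fixes f :: "'t::topological_space \<Rightarrow> real ^ 'q"
  assumes L: "compact L" and f: "f \<in> paths"
  shows "openin path_topology {g \<in> paths. \<forall>t\<in>L. dist (g t) (f t) < e}"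
  unfolding openin_path_topology
proof (intro conjI ballI)
  fix g assume g: "g \<in> {g \<in> paths. \<forall>t\<in>L. dist (g t) (f t) < e}"
  show "\<exists>L' e'. compact L' \<and> 0 < e' \<and>
      {h \<in> paths. \<forall>t\<in>L'. dist (h t) (g t) < e'} \<subseteq> {g \<in> paths. \<forall>t\<in>L. dist (g t) (f t) < e}"
  proof (cases "L = {}")
    case True
    then show ?thesis by (intro exI[of _ "{}"] exI[of _ 1]) auto
  next
    case False
    have "continuous_on L (\<lambda>t. dist (g t) (f t))"
      using f g unfolding paths_def
      by (auto intro!: continuous_intros intro: continuous_on_subset)
    from continuous_attains_sup[OF L False this] obtain t0 where
      t0: "t0 \<in> L" "\<And>t. t \<in> L \<Longrightarrow> dist (g t) (f t) \<le> dist (g t0) (f t0)" by blast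
    define e' where "e' = e - dist (g t0) (f t0)"
    have "dist (h t) (f t) < e" if "t \<in> L" "dist (h t) (g t) < e'" for h t
      using dist_triangle[of "h t" "f t" "g t"] t0(2)[OF that(1)] that(2) unfolding e'_def by linarith
    moreover have "e' > 0" using g t0(1) unfolding e'_def by auto
    ultimately show ?thesis using L by (intro exI[of _ L] exI[of _ e']) auto
  qed
qed auto

lemma odot_in_paths: "f \<in> paths \<Longrightarrow> r \<odot> f \<in> paths"
  unfolding odot_def paths_def
  by (auto intro!: continuous_on_vec_lambda continuous_intros)

lemma norm_mult_components_le:
  fixes x y :: "real ^ 'q"
  shows "norm (\<chi> i. x $ i * y $ i) \<le> norm x * norm y"
proof -
  have "norm (\<chi> i. x $ i * y $ i) \<le> norm (norm x *\<^sub>R y)"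
    by (rule norm_le_componentwise_cart)
      (simp add: abs_mult mult_right_mono component_le_norm_cart)
  then show ?thesis by simp
qed

text \<open>Split s*g - r*f into s*(g - f) + (s - r)*f and use that f is bounded on the compact set.
  The conclusion is a rectangle of neighbourhoods, which can be combined with a countable basis on
  the scale side.\<close>

lemma odot_jointly_continuous:
  fixes f :: "'t::topological_space \<Rightarrow> real ^ 'q"
  assumes U: "openin path_topology U" and f: "f \<in> paths" and rf: "r \<odot> f \<in> U"
  obtains V W where "open V" "r \<in> V" "openin path_topology W" "f \<in> W"
    "\<And>s g. s \<in> V \<Longrightarrow> g \<in> W \<Longrightarrow> s \<odot> g \<in> U"
proof -
  obtain L e where L: "compact L" "e > 0"
      "{g \<in> paths. \<forall>t\<in>L. dist (g t) ((r \<odot> f) t) < e} \<subseteq> U"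
    using U rf unfolding openin_path_topology by meson
  have "bounded (f ` L)"
    using f L(1) unfolding paths_def
    by (intro compact_imp_bounded compact_continuous_image) (auto intro: continuous_on_subset)
  then obtain b where b: "b > 0" "\<And>t. t \<in> L \<Longrightarrow> norm (f t) \<le> b"
    unfolding bounded_pos by auto
  \<comment> \<open>Each radius keeps one of the two summands within e/2. The cap 1 in
    \<open>\<delta>\<close> bounds the norm of s by \<open>norm r + 1\<close>, the factor that
    appears in \<open>\<eta>\<close>.\<close>
  define \<delta> where "\<delta> = min 1 (e / (2 * b))"
  define \<eta> where "\<eta> = e / (2 * (norm r + 1))"
  have rp: "norm r + 1 > 0" by (smt (verit) norm_ge_zero)
  have pos: "\<delta> > 0" "\<eta> > 0" using L(2) b(1) rp unfolding \<delta>_def \<eta>_def by auto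
  show thesis
  proof
    show "open (ball r \<delta>)" "r \<in> ball r \<delta>" using pos by auto
    show "openin path_topology {g \<in> paths. \<forall>t\<in>L. dist (g t) (f t) < \<eta>}"
      by (rule openin_path_ball[OF L(1) f])
    show "f \<in> {g \<in> paths. \<forall>t\<in>L. dist (g t) (f t) < \<eta>}" using f pos by auto
    fix s g assume s: "s \<in> ball r \<delta>" and g: "g \<in> {g \<in> paths. \<forall>t\<in>L. dist (g t) (f t) < \<eta>}"
    have "dist ((s \<odot> g) t) ((r \<odot> f) t) < e" if t: "t \<in> L" for t
    proof -
      have sr: "norm (s - r) < \<delta>" using s by (simp add: dist_norm norm_minus_commute)
      have "norm s \<le> norm (s - r) + norm r" using norm_triangle_ineq[of "s - r" r] by simp
      then have ns: "norm s \<le> norm r + 1" using sr unfolding \<delta>_def by linarith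
      have gf: "norm (g t - f t) < \<eta>" using g t by (simp add: dist_norm)
      have "(s \<odot> g) t - (r \<odot> f) t =
          (\<chi> i. s $ i * (g t - f t) $ i) + (\<chi> i. (s - r) $ i * f t $ i)"
        by (simp add: odot_def vec_eq_iff algebra_simps)
      then have "norm ((s \<odot> g) t - (r \<odot> f) t) \<le>
          norm (\<chi> i. s $ i * (g t - f t) $ i) + norm (\<chi> i. (s - r) $ i * f t $ i)"
        by (simp only: norm_triangle_ineq)
      also have "\<dots> \<le> norm s * norm (g t - f t) + norm (s - r) * norm (f t)"
        by (intro add_mono norm_mult_components_le)
      also have "\<dots> < e / 2 + e / 2"
      proof (rule add_less_le_mono)
        have "norm s * norm (g t - f t) \<le> (norm r + 1) * norm (g t - f t)"
          by (intro mult_right_mono ns) simp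
        also have "\<dots> < (norm r + 1) * \<eta>" using gf rp by (intro mult_strict_left_mono)
        also have "\<dots> = e / 2" using rp unfolding \<eta>_def by (simp add: field_simps)
        finally show "norm s * norm (g t - f t) < e / 2" .
        have "norm (s - r) * norm (f t) \<le> \<delta> * b"
          using sr b(2)[OF t] b(1) pos by (intro mult_mono) auto
        also have "\<dots> \<le> e / (2 * b) * b"
          using b(1) unfolding \<delta>_def by (intro mult_right_mono) auto
        also have "\<dots> = e / 2" using b(1) by simp
        finally show "norm (s - r) * norm (f t) \<le> e / 2" .
      qed
      finally show ?thesis by (simp add: dist_norm)
    qed
    then show "s \<odot> g \<in> U" using L(3) g odot_in_paths by blast
  qed
qed

text \<open>Second countability of the scale space alone makes the preimage of an open set a countable
  union of measurable rectangles; separability of the path space is not needed.\<close>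

lemma measurable_odot:
  "(\<lambda>(r, f). r \<odot> f) \<in> borel \<Otimes>\<^sub>M path_borel \<rightarrow>\<^sub>M (path_borel :: ('t::topological_space \<Rightarrow> real ^ 'q) measure)"
  unfolding path_borel_def[where ?'t = 't]
proof (rule measurable_measure_of)
  show "{U. openin path_topology U} \<subseteq> Pow (paths :: ('t \<Rightarrow> real ^ 'q) set)"
    using openin_path_topology by blast
  show "(\<lambda>(r, f). r \<odot> f) \<in> space (borel \<Otimes>\<^sub>M sigma paths {U. openin path_topology U}) \<rightarrow>
      (paths :: ('t \<Rightarrow> real ^ 'q) set)"
    unfolding path_borel_def[symmetric] by (auto simp: space_pair_measure odot_in_paths)
  fix U :: "('t \<Rightarrow> real ^ 'q) set" assume "U \<in> {U. openin path_topology U}"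
  then have U: "openin path_topology U" by simp
  obtain B :: "(real ^ 'q) set set" where B: "countable B" "topological_basis B"
    using ex_countable_basis by blast
  define W where "W b = \<Union>{W. openin path_topology W \<and> (\<forall>s\<in>b. \<forall>g\<in>W. s \<odot> g \<in> U)}" for b
  have openW: "openin path_topology (W b)" for b unfolding W_def by (rule openin_Union) simp
  have "(\<lambda>(r, f). r \<odot> f) -` U \<inter> space (borel \<Otimes>\<^sub>M path_borel) = (\<Union>b\<in>B. b \<times> W b)"
  proof (intro equalityI subsetI)
    fix p assume "p \<in> (\<lambda>(r, f). r \<odot> f) -` U \<inter> space (borel \<Otimes>\<^sub>M path_borel)"
    then obtain r f where p: "p = (r, f)" "f \<in> paths" "r \<odot> f \<in> U"
      by (auto simp: space_pair_measure)
    obtain V W' where VW: "open V" "r \<in> V" "openin path_topology W'" "f \<in> W'"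
        "\<And>s g. s \<in> V \<Longrightarrow> g \<in> W' \<Longrightarrow> s \<odot> g \<in> U"
      using odot_jointly_continuous[OF U p(2,3)] by blast
    obtain b where "b \<in> B" "r \<in> b" "b \<subseteq> V"
      using topological_basisE[OF B(2) VW(1,2)] by blast
    with VW show "p \<in> (\<Union>b\<in>B. b \<times> W b)" unfolding p W_def by blast
  next
    fix p assume "p \<in> (\<Union>b\<in>B. b \<times> W b)"
    moreover have "W b \<subseteq> paths" for b using openW openin_path_topology by blast
    ultimately show "p \<in> (\<lambda>(r, f). r \<odot> f) -` U \<inter> space (borel \<Otimes>\<^sub>M path_borel)"
      unfolding W_def by (auto simp: space_pair_measure)
  qed
  also have "\<dots> \<in> sets (borel \<Otimes>\<^sub>M path_borel)"
  proof (rule sets.countable_UN''[OF B(1)])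
    fix b assume "b \<in> B"
    then have "open b" by (rule topological_basis_open[OF B(2)])
    then show "b \<times> W b \<in> sets (borel \<Otimes>\<^sub>M path_borel)"
      using openW by (intro pair_measureI openin_path_borel) simp_all
  qed
  finally show "(\<lambda>(r, f). r \<odot> f) -` U \<inter> space (borel \<Otimes>\<^sub>M sigma paths {U. openin path_topology U})
      \<in> sets (borel \<Otimes>\<^sub>M sigma paths {U. openin path_topology U})"
    unfolding path_borel_def .
qed

lemma measurable_odot' [measurable (raw)]:
  fixes f :: "'w \<Rightarrow> 't::topological_space \<Rightarrow> real ^ 'q"
  assumes "r \<in> borel_measurable M" "f \<in> M \<rightarrow>\<^sub>M path_borel"
  shows "(\<lambda>\<omega>. r \<omega> \<odot> f \<omega>) \<in> M \<rightarrow>\<^sub>M path_borel"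
  using measurable_compose[OF measurable_Pair[OF assms] measurable_odot] by simp

section \<open>Sup-norms over the levels of the exhaustion\<close>

locale index_exhaustion =
  fixes K :: "nat \<Rightarrow> 't::topological_space set"
  assumes exhaustion: "exhaustion K"
begin

lemma compact_level: "n \<ge> 1 \<Longrightarrow> compact (K n)" and nonempty_level: "n \<ge> 1 \<Longrightarrow> K n \<noteq> {}"
  using exhaustion unfolding exhaustion_def by auto

lemma level_mono:
  assumes "1 \<le> m" "m \<le> n"
  shows "K m \<subseteq> K n"
  using assms(2)
proof (induction n rule: dec_induct)
  case (step n)
  then have "K n \<subseteq> K (Suc n)" using assms(1) exhaustion by (simp add: exhaustion_def)
  with step show ?case by simp
qed simp

lemma bdd_above_component:
  assumes "f \<in> paths" "n \<ge> 1"
  shows "bdd_above ((\<lambda>t. \<bar>f t $ i\<bar>) ` K n)"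
  by (intro bounded_imp_bdd_above compact_imp_bounded compact_continuous_image
      compact_level continuous_intros paths_component assms)

text \<open>Homogeneity, measurability and positivity of the sup-norms are all read off from a
  single witnessing point.\<close>

lemma rho_greater_iff:
  fixes f :: "'t \<Rightarrow> real ^ 'q"
  assumes "f \<in> paths" "n \<ge> 1"
  shows "a < rho K n i f \<longleftrightarrow> (\<exists>t\<in>K n. a < \<bar>f t $ i\<bar>)"
  unfolding rho_def by (rule less_cSUP_iff[OF nonempty_level[OF assms(2)] bdd_above_component[OF assms]])

lemma rho_nonneg: "f \<in> paths \<Longrightarrow> n \<ge> 1 \<Longrightarrow> 0 \<le> rho K n i f"
  using rho_greater_iff[of f n "rho K n i f" i] nonempty_level[of n]
  by (smt (verit) abs_ge_zero ex_in_conv)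

lemma rho_mono: "f \<in> paths \<Longrightarrow> 1 \<le> m \<Longrightarrow> m \<le> n \<Longrightarrow> rho K m i f \<le> rho K n i f"
  unfolding rho_def
  by (intro cSUP_subset_mono nonempty_level bdd_above_component level_mono) auto

lemma rho_odot:
  assumes f: "f \<in> paths" and n: "n \<ge> 1" and r: "0 < r $ i"
  shows "rho K n i (r \<odot> f) = r $ i * rho K n i f"
proof -
  have "a < rho K n i (r \<odot> f) \<longleftrightarrow> a < r $ i * rho K n i f" for a
  proof -
    have "a < rho K n i (r \<odot> f) \<longleftrightarrow> (\<exists>t\<in>K n. a < \<bar>r $ i * f t $ i\<bar>)"
      unfolding rho_greater_iff[OF odot_in_paths[OF f] n] by (simp add: odot_def)
    also have "\<dots> \<longleftrightarrow> (\<exists>t\<in>K n. a / r $ i < \<bar>f t $ i\<bar>)"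
      using r by (simp add: abs_mult divide_less_eq mult.commute)
    also have "\<dots> \<longleftrightarrow> a / r $ i < rho K n i f" unfolding rho_greater_iff[OF f n] ..
    finally show ?thesis using r by (simp add: divide_less_eq mult.commute)
  qed
  \<comment> \<open>Two reals with the same strict lower bounds are equal.\<close>
  then show ?thesis by (meson linorder_neq_iff order_less_irrefl)
qed

text \<open>A strict inequality at one point t survives every perturbation that is small at t.
  Superlevel sets are therefore open, with \<open>{t}\<close> as the compact set.\<close>

lemma measurable_rho [measurable]:
  assumes n: "n \<ge> 1"
  shows "rho K n i \<in> borel_measurable (path_borel :: ('t \<Rightarrow> real ^ 'q) measure)"
  unfolding borel_measurable_iff_greater
proof
  fix a
  have "openin path_topology {f \<in> (paths :: ('t \<Rightarrow> real ^ 'q) set). \<exists>t\<in>K n. a < \<bar>f t $ i\<bar>}"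
    unfolding openin_path_topology
  proof (intro conjI ballI)
    fix f :: "'t \<Rightarrow> real ^ 'q" assume "f \<in> {f \<in> paths. \<exists>t\<in>K n. a < \<bar>f t $ i\<bar>}"
    then obtain t where t: "t \<in> K n" "a < \<bar>f t $ i\<bar>" by auto
    have "a < \<bar>g t $ i\<bar>" if "dist (g t) (f t) < \<bar>f t $ i\<bar> - a" for g
      using that component_le_norm_cart[of "g t - f t" i] by (simp add: dist_norm)
    then show "\<exists>L e. compact L \<and> 0 < e \<and> {g \<in> paths. \<forall>t\<in>L. dist (g t) (f t) < e}
        \<subseteq> {f \<in> paths. \<exists>t\<in>K n. a < \<bar>f t $ i\<bar>}"
      using t by (intro exI[of _ "{t}"] exI[of _ "\<bar>f t $ i\<bar> - a"]) auto
  qed auto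
  then show "{f \<in> space path_borel. a < rho K n i (f :: 't \<Rightarrow> real ^ 'q)} \<in> sets path_borel"
    using openin_path_borel by (simp add: rho_greater_iff[OF _ n] cong: conj_cong)
qed

lemma mem_paths0_iff:
  "f \<in> paths0 \<longleftrightarrow> f \<in> paths \<and> (\<exists>m. \<forall>i. 0 < rho K (Suc m) i f)"
proof -
  have "f \<in> paths0 \<longleftrightarrow> f \<in> paths \<and> (\<forall>i. \<exists>t. 0 < \<bar>f t $ i\<bar>)"
    unfolding paths0_def D_Pi_def by auto
  moreover have "(\<forall>i. \<exists>t. 0 < \<bar>f t $ i\<bar>) \<longleftrightarrow> (\<exists>m. \<forall>i. 0 < rho K (Suc m) i f)" if f: "f \<in> paths"
  proof
    assume "\<forall>i. \<exists>t. 0 < \<bar>f t $ i\<bar>"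
    then obtain t where t: "\<And>i. 0 < \<bar>f (t i) $ i\<bar>" by metis
    obtain n where n: "n \<ge> 1" "range t \<subseteq> K n"
      using exhaustion finite_imp_compact[of "range t"] unfolding exhaustion_def by auto
    then have "0 < rho K n i f" for i using t by (auto simp: rho_greater_iff[OF f n(1)])
    with n(1) show "\<exists>m. \<forall>i. 0 < rho K (Suc m) i f" by (metis Suc_le_D One_nat_def)
  qed (auto simp: rho_greater_iff[OF f])
  ultimately show ?thesis by auto
qed

lemma sets_paths0 [measurable]: "paths0 \<in> sets (path_borel :: ('t \<Rightarrow> real ^ 'q) measure)"
proof -
  have "paths0 = {f \<in> space path_borel. \<exists>m. \<forall>i. 0 < rho K (Suc m) i (f :: 't \<Rightarrow> real ^ 'q)}"
    by (rule set_eqI) (simp add: mem_paths0_iff)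
  also have "\<dots> \<in> sets path_borel" by measurable
  finally show ?thesis .
qed

lemma sets_paths0_Int_space:
  "paths0 \<inter> space path_borel \<in> sets (path_borel :: ('t \<Rightarrow> real ^ 'q) measure)"
  by (intro sets.Int sets_paths0 sets.top)

lemma sets_window [measurable]:
  assumes "n \<in> pos_indices"
  shows "window K n \<epsilon> \<in> sets path_borel"
proof -
  have [measurable]: "rho K (n i) i \<in> borel_measurable path_borel" for i
    using assms by (intro measurable_rho) (auto simp: pos_indices_def)
  have "window K n \<epsilon> = {f \<in> space path_borel. \<forall>i. \<epsilon> $ i < rho K (n i) i f}"
    by (auto simp: window_def)
  also have "\<dots> \<in> sets path_borel" by measurable
  finally show ?thesis .
qed

end

section \<open>The scaling action of the positive orthant\<close>

lemma odot_odot: "r \<odot> s \<odot> f = (\<chi> i. r $ i * s $ i) \<odot> f"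
  by (simp add: odot_def fun_eq_iff vec_eq_iff mult.assoc)

lemma vec_inverse_odot_cancel:
  assumes "r \<in> pos_orthant"
  shows "vec_inverse r \<odot> r \<odot> f = f" "r \<odot> vec_inverse r \<odot> f = f"
  using assms by (auto simp: odot_def fun_eq_iff vec_eq_iff vec_inverse_def pos_orthant_def
      less_imp_neq[symmetric] mult.assoc[symmetric])

lemma odot_in_paths0_iff:
  assumes "r \<in> pos_orthant"
  shows "r \<odot> f \<in> paths0 \<longleftrightarrow> f \<in> paths0"
proof -
  have "s \<odot> g \<in> paths0" if "s \<in> pos_orthant" "g \<in> paths0" for s g
    using that odot_in_paths[of g s]
    unfolding paths0_def D_Pi_def pos_orthant_def by (auto simp: odot_def less_imp_neq[symmetric])
  moreover have "vec_inverse r \<in> pos_orthant"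
    using assms by (simp add: pos_orthant_def vec_inverse_def)
  ultimately show ?thesis using assms vec_inverse_odot_cancel(1)[OF assms, of f] by metis
qed

section \<open>The scale measure\<close>

lemma nn_integral_lborel_vec_prod:
  fixes g :: "'q::finite \<Rightarrow> real \<Rightarrow> ennreal"
  assumes [measurable]: "\<And>i. g i \<in> borel_measurable borel"
  shows "(\<integral>\<^sup>+ r. (\<Prod>i\<in>UNIV. g i (r $ i)) \<partial>lborel) = (\<Prod>i\<in>UNIV. \<integral>\<^sup>+ x. g i x \<partial>lborel)"
proof -
  \<comment> \<open>\<open>nn_integral_lborel_prod\<close> indexes its factors by basis vectors, so
    \<open>h\<close> recovers the coordinate i from the vector \<open>axis i 1\<close>.\<close>
  define h where "h b = g (THE i. b = axis i (1::real))" for b :: "real ^ 'q"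
  have h: "h (axis i 1) = g i" for i by (simp add: h_def axis_eq_axis)
  have [measurable]: "h b \<in> borel_measurable borel" for b unfolding h_def by measurable
  have Basis: "(Basis :: (real ^ 'q) set) = range (\<lambda>i. axis i 1)" by (auto simp: Basis_vec_def)
  have inj: "inj (\<lambda>i::'q. axis i (1::real))" by (simp add: inj_on_def axis_eq_axis)
  have reindex: "(\<Prod>b\<in>Basis. F b) = (\<Prod>i\<in>UNIV. F (axis i 1))" for F :: "real ^ 'q \<Rightarrow> ennreal"
    unfolding Basis by (simp add: prod.reindex[OF inj])
  show ?thesis
    using nn_integral_lborel_prod[of h] by (simp add: reindex h inner_axis)
qed

text \<open>The one-dimensional factor of \<open>theta\<close>. For a > 0 its mass near 0 is
  infinite; the Pareto law is its restriction to the half-line above 1.\<close>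

definition pareto_density :: "real \<Rightarrow> real \<Rightarrow> ennreal" where
  "pareto_density a x = (if 0 < x then ennreal (a * x powr (- a - 1)) else 0)"

lemma measurable_pareto_density [measurable]: "pareto_density a \<in> borel_measurable borel"
  unfolding pareto_density_def by measurable

lemma measurable_pos_orthant [measurable]: "pos_orthant \<in> sets (borel :: (real ^ 'q) measure)"
  unfolding pos_orthant_def by measurable

text \<open>The product form allows integration coordinate by coordinate. Outside the orthant some
  factor is zero, in agreement with the extension by zero.\<close>

lemma theta_eq_density:
  fixes \<alpha> :: "real ^ 'q"
  assumes "\<forall>i. 0 < \<alpha> $ i"
  shows "theta \<alpha> = density lborel (\<lambda>r. \<Prod>i\<in>UNIV. pareto_density (\<alpha> $ i) (r $ i))"
  unfolding theta_def
proof (rule arg_cong[where f = "density lborel"], rule ext)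
  fix r :: "real ^ 'q"
  show "(if r \<in> pos_orthant then ennreal (\<Prod>i\<in>UNIV. \<alpha> $ i * r $ i powr (- \<alpha> $ i - 1)) else 0) =
      (\<Prod>i\<in>UNIV. pareto_density (\<alpha> $ i) (r $ i))"
  proof (cases "r \<in> pos_orthant")
    case True
    then show ?thesis using assms
      by (simp add: pareto_density_def pos_orthant_def prod_ennreal less_imp_le)
  next
    case False
    then obtain i where "\<not> 0 < r $ i" by (auto simp: pos_orthant_def)
    then have "pareto_density (\<alpha> $ i) (r $ i) = 0" by (simp add: pareto_density_def)
    then have "(\<Prod>i\<in>UNIV. pareto_density (\<alpha> $ i) (r $ i)) = 0" by (intro prod_zero) auto
    then show ?thesis using False by simp
  qed
qed

lemma sets_theta [simp, measurable_cong]: "sets (theta \<alpha>) = sets borel"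
  and space_theta [simp]: "space (theta \<alpha>) = UNIV"
  by (simp_all add: theta_def)

lemma nn_integral_theta_prod:
  fixes \<alpha> :: "real ^ 'q" and h :: "'q \<Rightarrow> real \<Rightarrow> ennreal"
  assumes "\<forall>i. 0 < \<alpha> $ i" and [measurable]: "\<And>i. h i \<in> borel_measurable borel"
  shows "(\<integral>\<^sup>+ r. (\<Prod>i\<in>UNIV. h i (r $ i)) \<partial>theta \<alpha>) =
    (\<Prod>i\<in>UNIV. \<integral>\<^sup>+ x. pareto_density (\<alpha> $ i) x * h i x \<partial>lborel)"
  unfolding theta_eq_density[OF assms(1)]
  using nn_integral_lborel_vec_prod[of "\<lambda>i x. pareto_density (\<alpha> $ i) x * h i x"]
  by (subst nn_integral_density) (simp_all add: prod.distrib)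

lemma sigma_finite_theta:
  assumes "\<forall>i. 0 < \<alpha> $ i"
  shows "sigma_finite_measure (theta \<alpha>)"
proof -
  have "(\<Prod>i\<in>UNIV. pareto_density (\<alpha> $ i) (r $ i)) \<noteq> \<infinity>" for r :: "real ^ 'a"
    by (simp add: ennreal_prod_eq_top pareto_density_def)
  then show ?thesis unfolding theta_eq_density[OF assms]
    by (subst sigma_finite_measure.sigma_finite_iff_density_finite[OF sigma_finite_lborel]) auto
qed

lemma AE_theta_pos_orthant:
  fixes \<alpha> :: "real ^ 'q"
  assumes "\<forall>i. 0 < \<alpha> $ i"
  shows "AE r in theta \<alpha>. r \<in> pos_orthant"
proof -
  have "r \<in> pos_orthant" if "0 < (\<Prod>i\<in>UNIV. pareto_density (\<alpha> $ i) (r $ i))" for r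
  proof (rule ccontr)
    assume "r \<notin> pos_orthant"
    then obtain i where "\<not> 0 < r $ i" by (auto simp: pos_orthant_def)
    then have "pareto_density (\<alpha> $ i) (r $ i) = 0" by (simp add: pareto_density_def)
    then have "(\<Prod>i\<in>UNIV. pareto_density (\<alpha> $ i) (r $ i)) = 0" by (intro prod_zero) auto
    with that show False by simp
  qed
  then show ?thesis unfolding theta_eq_density[OF assms] by (subst AE_density) auto
qed

lemma nn_integral_pareto_tail:
  assumes a: "0 < a" and x: "0 < x"
  shows "(\<integral>\<^sup>+ s. pareto_density a s * indicator {x<..} s \<partial>lborel) = ennreal (x powr (- a))"
proof -
  have "(\<integral>\<^sup>+ s. pareto_density a s * indicator {x<..} s \<partial>lborel) =
      (\<integral>\<^sup>+ s. ennreal (a * s powr (- a - 1)) * indicator {x..} s \<partial>lborel)"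
  \<comment> \<open>The endpoint is a null set; closing the half-line gives the standard improper
    integral of a power.\<close>
  proof (rule nn_integral_cong_AE, rule AE_mp[OF AE_lborel_singleton[of x]], rule AE_I2, rule impI)
    fix s assume "s \<noteq> x"
    then show "pareto_density a s * indicator {x<..} s =
        ennreal (a * s powr (- a - 1)) * indicator {x..} s"
      using x by (simp add: pareto_density_def indicator_def)
  qed
  also have "\<dots> = ennreal (a * (- (x powr (- a - 1 + 1)) / (- a - 1 + 1)))"
    using a x by (intro nn_integral_has_integral_lebesgue' has_integral_mult_right
        has_integral_powr_to_inf) auto
  also have "\<dots> = ennreal (x powr (- a))" using a by simp
  finally show ?thesis .
qed

text \<open>After cancellation the integrand is the derivative of (s/x)^a on (0,x). This is the
  one-dimensional normalisation of the kernel \<open>k\<close> in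
  \<open>emeasure_disintegration\<close>.\<close>

lemma nn_integral_pareto_reciprocal:
  assumes a: "0 < a" and x: "0 < x"
  shows "(\<integral>\<^sup>+ s. pareto_density a s *
    (ennreal (s powr a * s powr a * x powr (- a)) * indicator {..<x} s) \<partial>lborel) = 1"
proof -
  have "(\<integral>\<^sup>+ s. pareto_density a s *
      (ennreal (s powr a * s powr a * x powr (- a)) * indicator {..<x} s) \<partial>lborel) =
      (\<integral>\<^sup>+ s. ennreal (x powr (- a) * a * s powr (a - 1)) * indicator {0..x} s \<partial>lborel)"
  proof (rule nn_integral_cong_AE, rule AE_mp[OF AE_lborel_singleton[of x]],
      rule AE_mp[OF AE_lborel_singleton[of 0]], rule AE_I2, intro impI)
    fix s :: real assume s: "s \<noteq> 0" "s \<noteq> x"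
    have "s powr (- a - 1) * (s powr a * s powr a) = s powr (a - 1)"
      by (simp add: powr_add[symmetric])
    then have "ennreal (a * s powr (- a - 1)) * ennreal (s powr a * s powr a * x powr (- a)) =
        ennreal (x powr (- a) * a * s powr (a - 1))"
      using a by (subst ennreal_mult[symmetric]) (auto simp: mult_ac)
    with s show "pareto_density a s *
        (ennreal (s powr a * s powr a * x powr (- a)) * indicator {..<x} s) =
        ennreal (x powr (- a) * a * s powr (a - 1)) * indicator {0..x} s"
      by (auto simp: pareto_density_def indicator_def)
  qed
  also have "\<dots> = ennreal (x powr (- a) * a * (x powr (a - 1 + 1) / (a - 1 + 1)))"
    using a x by (intro nn_integral_has_integral_lebesgue' has_integral_mult_right
        has_integral_powr_from_0) auto
  also have "\<dots> = 1" using a x by (simp add: powr_minus)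
  finally show ?thesis .
qed

lemma chi_pow_pos: "r \<in> pos_orthant \<Longrightarrow> 0 < chi_pow \<alpha> r"
  unfolding chi_pow_def pos_orthant_def by (auto intro!: prod_pos simp: less_imp_neq[symmetric])

text \<open>Linear change of variables: each coordinate contributes the Jacobian factor u_i, and the
  density, homogeneous of degree -\<alpha>_i - 1, reduces it to u_i to the power
  -\<alpha>_i.\<close>

lemma nn_integral_theta_scale:
  fixes \<alpha> u :: "real ^ 'q" and F :: "real ^ 'q \<Rightarrow> ennreal"
  assumes u: "u \<in> pos_orthant" and alpha: "\<forall>i. 0 < \<alpha> $ i"
    and [measurable]: "F \<in> borel_measurable borel"
  shows "(\<integral>\<^sup>+ r. F (\<chi> i. u $ i * r $ i) \<partial>theta \<alpha>) = ennreal (chi_pow \<alpha> u) * (\<integral>\<^sup>+ r. F r \<partial>theta \<alpha>)"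
proof -
  let ?T = "\<lambda>r :: real ^ 'q. \<chi> i. u $ i * r $ i"
  let ?d = "\<lambda>r :: real ^ 'q. \<Prod>i\<in>UNIV. pareto_density (\<alpha> $ i) (r $ i)"
  have u_pos: "0 < u $ i" for i using u by (simp add: pos_orthant_def)
  have [measurable]: "?T \<in> borel \<rightarrow>\<^sub>M borel"
    by (intro borel_measurable_continuous_onI continuous_on_vec_lambda continuous_intros)
  have Basis: "(Basis :: (real ^ 'q) set) = range (\<lambda>i. axis i 1)" by (auto simp: Basis_vec_def)
  have inj: "inj (\<lambda>i::'q. axis i (1::real))" by (simp add: inj_on_def axis_eq_axis)
  have sum_axis: "(\<Sum>i\<in>UNIV. c i *\<^sub>R axis i (1::real)) = (\<chi> i. c i)" for c :: "'q \<Rightarrow> real"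
    by (simp add: vec_eq_iff axis_def if_distrib cong: if_cong)
  \<comment> \<open>The diagonal map is put into the basis form, with zero translation, of
    \<open>lborel_affine_euclidean\<close>.\<close>
  have T: "?T = (\<lambda>x. 0 + (\<Sum>j\<in>Basis. ((u \<bullet> j) * (x \<bullet> j)) *\<^sub>R j))"
    unfolding Basis sum.reindex[OF inj] by (simp add: inner_axis sum_axis)
  have det: "(\<Prod>j\<in>Basis. \<bar>u \<bullet> j\<bar>) = (\<Prod>i\<in>UNIV. u $ i)"
    unfolding Basis prod.reindex[OF inj] using u_pos by (simp add: inner_axis less_imp_le)
  have nz: "u \<bullet> j \<noteq> 0" if "j \<in> Basis" for j
    using that u_pos unfolding Basis by (auto simp: inner_axis less_imp_neq[symmetric])
  have lborel: "lborel = density (distr lborel borel ?T) (\<lambda>_. \<Prod>i\<in>UNIV. u $ i)"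
    using lborel_affine_euclidean[of "\<lambda>j. u \<bullet> j" 0] u_pos
    unfolding T[symmetric] det using nz by simp
  have pareto_scale: "ennreal (u $ i) * pareto_density (\<alpha> $ i) (u $ i * x) =
      ennreal (u $ i powr (- \<alpha> $ i)) * pareto_density (\<alpha> $ i) x" for i x
  proof (cases "0 < x")
    case True
    have "u $ i * (\<alpha> $ i * (u $ i * x) powr (- \<alpha> $ i - 1)) =
        u $ i powr (- \<alpha> $ i) * (\<alpha> $ i * x powr (- \<alpha> $ i - 1))"
      using True u_pos[of i] by (simp add: powr_mult powr_diff)
    then show ?thesis using True u_pos[of i] alpha
      by (simp add: pareto_density_def ennreal_mult[symmetric] less_imp_le)
  qed (use u_pos[of i] in \<open>simp add: pareto_density_def zero_less_mult_iff\<close>)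
  have chi: "(\<Prod>i\<in>UNIV. ennreal (u $ i powr (- \<alpha> $ i))) = ennreal (inverse (chi_pow \<alpha> u))"
    unfolding chi_pow_def by (simp add: prod_ennreal powr_minus prod_inversef[symmetric])
  have "ennreal (\<Prod>i\<in>UNIV. u $ i) = (\<Prod>i\<in>UNIV. ennreal (u $ i))"
    using u_pos by (simp add: prod_ennreal less_imp_le)
  then have d_scale: "ennreal (\<Prod>i\<in>UNIV. u $ i) * ?d (?T r) = ennreal (inverse (chi_pow \<alpha> u)) * ?d r" for r
    by (simp only: chi[symmetric] prod.distrib[symmetric] vec_lambda_beta pareto_scale)
  have "(\<integral>\<^sup>+ r. F r \<partial>theta \<alpha>) = (\<integral>\<^sup>+ r. ?d r * F r \<partial>lborel)"
    unfolding theta_eq_density[OF alpha] by (subst nn_integral_density) simp_all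
  also have "\<dots> = (\<integral>\<^sup>+ r. ennreal (\<Prod>i\<in>UNIV. u $ i) * (?d (?T r) * F (?T r)) \<partial>lborel)"
    by (subst lborel) (simp add: nn_integral_density nn_integral_distr)
  also have "\<dots> = (\<integral>\<^sup>+ r. ennreal (inverse (chi_pow \<alpha> u)) * (?d r * F (?T r)) \<partial>lborel)"
    unfolding mult.assoc[symmetric] d_scale ..
  also have "\<dots> = ennreal (inverse (chi_pow \<alpha> u)) * (\<integral>\<^sup>+ r. F (?T r) \<partial>theta \<alpha>)"
    unfolding theta_eq_density[OF alpha]
    by (simp add: nn_integral_density nn_integral_cmult)
  finally have eq: "(\<integral>\<^sup>+ r. F r \<partial>theta \<alpha>) =
    ennreal (inverse (chi_pow \<alpha> u)) * (\<integral>\<^sup>+ r. F (?T r) \<partial>theta \<alpha>)" .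
  \<comment> \<open>The change of variables produced the reciprocal factor; \<open>chi_pow\<close>
    is positive and finite, so it can be moved to the other side.\<close>
  have "ennreal (chi_pow \<alpha> u) * ennreal (inverse (chi_pow \<alpha> u)) = 1"
    using chi_pow_pos[OF u, of \<alpha>] by (simp add: ennreal_mult[symmetric])
  then show ?thesis unfolding eq mult.assoc[symmetric] by simp
qed

lemma prod_indicator:
  "(\<Prod>i\<in>(UNIV :: 'q::finite set). indicator (A i) (x i) :: ennreal) = indicator {y. \<forall>i. y i \<in> A i} x"
proof (cases "\<forall>i. x i \<in> A i")
  case False
  then obtain i where "x i \<notin> A i" by blast
  then have "indicator (A i) (x i) = (0 :: ennreal)" by simp
  then have "(\<Prod>i\<in>UNIV. indicator (A i) (x i) :: ennreal) = 0" 
    by (intro prod_zero bexI[of _ i]) simp_all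
  with False show ?thesis by simp
qed simp

lemma emeasure_theta_orthant:
  fixes \<alpha> x :: "real ^ 'q"
  assumes "\<forall>i. 0 < \<alpha> $ i" "x \<in> pos_orthant"
  shows "emeasure (theta \<alpha>) {r. \<forall>i. x $ i < r $ i} = ennreal (\<Prod>i\<in>UNIV. x $ i powr (- \<alpha> $ i))"
proof -
  have "emeasure (theta \<alpha>) {r. \<forall>i. x $ i < r $ i} =
      (\<integral>\<^sup>+ r. (\<Prod>i\<in>UNIV. indicator {x $ i<..} (r $ i)) \<partial>theta \<alpha>)"
    unfolding prod_indicator
    by (subst nn_integral_indicator[symmetric])
      (simp, intro nn_integral_cong, simp add: indicator_def)
  also have "\<dots> = (\<Prod>i\<in>UNIV. \<integral>\<^sup>+ s. pareto_density (\<alpha> $ i) s * indicator {x $ i<..} s \<partial>lborel)"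
    using assms(1) by (rule nn_integral_theta_prod) simp
  also have "\<dots> = ennreal (\<Prod>i\<in>UNIV. x $ i powr (- \<alpha> $ i))"
    using assms by (simp add: nn_integral_pareto_tail pos_orthant_def prod_ennreal)
  finally show ?thesis .
qed

text \<open>Upper orthants are closed under intersection (take the componentwise maximum of the
  corners), generate the Borel sets, and exhaust the space as the corners (-n,...,-n) decrease.
  Uniqueness on a pi-system then applies.\<close>

lemma measure_eqI_orthant:
  fixes M N :: "(real ^ 'q) measure"
  assumes sets: "sets M = sets borel" "sets N = sets borel"
    and eq: "\<And>x. emeasure M {r. \<forall>i. x $ i < r $ i} = emeasure N {r. \<forall>i. x $ i < r $ i}"
    and finite: "\<And>x. emeasure M {r. \<forall>i. x $ i < r $ i} \<noteq> \<infinity>"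
  shows "M = N"
proof -
  let ?up = "\<lambda>x :: real ^ 'q. {r. \<forall>i. x $ i < r $ i}"
  let ?E = "range ?up"
  have up_sets: "?up x \<in> sets borel" for x by measurable
  have up_gen: "?up x \<in> sets (sigma UNIV ?E)" for x by (intro in_measure_of) auto
  have comp: "(\<lambda>r. r $ i) \<in> borel_measurable (sigma UNIV ?E)" for i
    unfolding borel_measurable_iff_greater
  proof
    fix a
    \<comment> \<open>A half-space in coordinate i is a countable union of orthants whose other
      thresholds tend to minus infinity.\<close>
    have "{r :: real ^ 'q. a < r $ i} = (\<Union>n. ?up (\<chi> j. if j = i then a else - real n))"
    proof (intro equalityI subsetI)
      fix r :: "real ^ 'q" assume r: "r \<in> {r. a < r $ i}"
      obtain n where n: "norm r < real n" using reals_Archimedean2 by blast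
      have "- real n < r $ j" for j
        using component_le_norm_cart[of r j] n by linarith
      then show "r \<in> (\<Union>n. ?up (\<chi> j. if j = i then a else - real n))" using r by auto
    qed (auto split: if_splits)
    also have "\<dots> \<in> sets (sigma UNIV ?E)" by (intro sets.countable_UN) (auto simp only: up_gen)
    finally show "{r \<in> space (sigma UNIV ?E). a < r $ i} \<in> sets (sigma UNIV ?E)" by simp
  qed
  have "(\<lambda>r. r) \<in> sigma UNIV ?E \<rightarrow>\<^sub>M (borel :: (real ^ 'q) measure)"
    by (rule borel_measurable_euclidean_space[THEN iffD2])
      (use comp in \<open>auto simp: Basis_vec_def inner_axis\<close>)
  then have sub: "sets borel \<subseteq> sigma_sets UNIV ?E"
    by (auto simp: measurable_def)
  moreover have "sigma_sets UNIV ?E \<subseteq> sets borel"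
    using sets.sigma_sets_subset[of ?E borel] up_sets by (simp only: space_borel) blast
  ultimately have gen: "sets borel = sigma_sets UNIV ?E" by simp
  have stable: "Int_stable ?E"
  proof (rule Int_stableI_image)
    fix x y :: "real ^ 'q"
    show "\<exists>z\<in>UNIV. ?up x \<inter> ?up y = ?up z"
      by (rule bexI[of _ "\<chi> i. max (x $ i) (y $ i)"]) auto
  qed
  have cover: "(\<Union>n. ?up (\<chi> j. - real n)) = UNIV"
  proof (intro equalityI subsetI)
    fix r :: "real ^ 'q"
    obtain n where n: "norm r < real n" using reals_Archimedean2 by blast
    have "- real n < r $ j" for j
      using component_le_norm_cart[of r j] n by linarith
    then show "r \<in> (\<Union>n. ?up (\<chi> j. - real n))" by auto
  qed simp
  show ?thesis
  proof (rule measure_eqI_generator_eq[OF stable])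
    show "?E \<subseteq> Pow UNIV" by (rule image_subsetI) (simp only: Pow_UNIV UNIV_I)
    show "sets M = sigma_sets UNIV ?E" "sets N = sigma_sets UNIV ?E"
      unfolding sets by (rule gen)+
    show "range (\<lambda>n. ?up (\<chi> j. - real n)) \<subseteq> ?E"
      by (rule image_subsetI) (rule rangeI)
    show "(\<Union>n. ?up (\<chi> j. - real n)) = UNIV" by (rule cover)
    show "emeasure M (?up (\<chi> j. - real n)) \<noteq> \<infinity>" for n by (rule finite)
    show "emeasure M X = emeasure N X" if "X \<in> ?E" for X
      by (rule rangeE[OF that]) (erule ssubst, rule eq)
  qed
qed

section \<open>Disintegration along scaling orbits\<close>

lemma borel_measurable_vec_lambda [measurable (raw)]:
  fixes g :: "'q::finite \<Rightarrow> 'a \<Rightarrow> real"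
  assumes "\<And>i. g i \<in> borel_measurable M"
  shows "(\<lambda>x. \<chi> i. g i x) \<in> borel_measurable M"
  by (rule borel_measurable_euclidean_space[THEN iffD2])
    (use assms in \<open>auto simp: Basis_vec_def inner_axis\<close>)

lemma borel_measurable_vec_component [measurable (raw)]:
  fixes f :: "'a \<Rightarrow> real ^ 'q"
  assumes "f \<in> borel_measurable M"
  shows "(\<lambda>x. f x $ i) \<in> borel_measurable M"
  using measurable_compose[OF assms borel_measurable_nth] .

lemma chi_pow_vec_inverse: "chi_pow \<alpha> (vec_inverse r) = inverse (chi_pow \<alpha> r)"
  by (cases "r \<in> pos_orthant") (simp_all add: chi_pow_def vec_inverse_def prod_inversef[symmetric] inverse_powr)

lemma vec_inverse_pos_orthant: "r \<in> pos_orthant \<Longrightarrow> vec_inverse r \<in> pos_orthant"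
  by (simp add: pos_orthant_def vec_inverse_def)

lemma emeasure_distr_odot:
  fixes Z :: "'w \<Rightarrow> 't::topological_space \<Rightarrow> real ^ 'q"
  assumes alpha: "\<forall>i. 0 < \<alpha> $ i" and [measurable]: "Z \<in> M \<rightarrow>\<^sub>M path_borel" "A \<in> sets path_borel"
  shows "emeasure (distr (M \<Otimes>\<^sub>M theta \<alpha>) path_borel (\<lambda>(\<omega>, s). s \<odot> Z \<omega>)) A =
    (\<integral>\<^sup>+ \<omega>. (\<integral>\<^sup>+ s. indicator A (s \<odot> Z \<omega>) \<partial>theta \<alpha>) \<partial>M)"
    (is "emeasure ?D A = _")
proof -
  interpret theta: sigma_finite_measure "theta \<alpha>" by (rule sigma_finite_theta[OF alpha])
  have "emeasure ?D A = (\<integral>\<^sup>+ p. indicator A ((\<lambda>(\<omega>, s). s \<odot> Z \<omega>) p) \<partial>(M \<Otimes>\<^sub>M theta \<alpha>))"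
    by (simp add: nn_integral_indicator[symmetric] nn_integral_distr del: nn_integral_indicator)
  also have "\<dots> = (\<integral>\<^sup>+ \<omega>. (\<integral>\<^sup>+ s. indicator A (s \<odot> Z \<omega>) \<partial>theta \<alpha>) \<partial>M)"
    by (subst theta.nn_integral_fst[symmetric]) simp_all
  finally show ?thesis .
qed

text \<open>\<open>measure_of\<close> has the intended values only if the given set function is a
  measure. Recognising it as that of an image measure supplies countable additivity at once.\<close>

lemma nu_of_eq_distr:
  fixes Z :: "'w \<Rightarrow> 't::topological_space \<Rightarrow> real ^ 'q"
  assumes alpha: "\<forall>i. 0 < \<alpha> $ i" and Z: "Z \<in> M \<rightarrow>\<^sub>M path_borel"
  shows "nu_of \<alpha> M Z = distr (M \<Otimes>\<^sub>M theta \<alpha>) path_borel (\<lambda>(\<omega>, s). s \<odot> Z \<omega>)"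
    (is "_ = ?D")
proof -
  have "nu_of \<alpha> M Z = measure_of (space ?D) (sets ?D) (emeasure ?D)"
    unfolding nu_of_def using sets.space_closed[of "path_borel :: ('t \<Rightarrow> real ^ 'q) measure"]
    by (auto simp: sets.sigma_sets_eq[of path_borel, simplified] emeasure_distr_odot[OF alpha Z]
        intro!: measure_of_eq)
  then show ?thesis by (simp only: measure_of_of_measure)
qed

lemma emeasure_nu_of:
  assumes "\<forall>i. 0 < \<alpha> $ i" "Z \<in> M \<rightarrow>\<^sub>M path_borel" "A \<in> sets path_borel"
  shows "emeasure (nu_of \<alpha> M Z) A = (\<integral>\<^sup>+ \<omega>. (\<integral>\<^sup>+ s. indicator A (s \<odot> Z \<omega>) \<partial>theta \<alpha>) \<partial>M)"
  unfolding nu_of_eq_distr[OF assms(1,2)] by (rule emeasure_distr_odot[OF assms])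

context index_exhaustion
begin

text \<open>For positive scales the scaled path enters the window iff every s_i exceeds the
  reciprocal of the i-th sup-norm, so the integral is the \<open>theta\<close>-mass of an orthant.
  Averaging over Z identifies the moments with window masses.\<close>

lemma nn_integral_theta_window:
  fixes \<alpha> :: "real ^ 'q"
  assumes alpha: "\<forall>i. 0 < \<alpha> $ i" and f: "f \<in> paths" and n: "n \<in> pos_indices"
  shows "(\<integral>\<^sup>+ s. indicator (window K n 1) (s \<odot> f) \<partial>theta \<alpha>) =
    ennreal (\<Prod>i\<in>UNIV. rho K (n i) i f powr \<alpha> $ i)"
proof -
  have n1: "1 \<le> n i" for i using n by (simp add: pos_indices_def)
  have window_iff: "s \<odot> f \<in> window K n 1 \<longleftrightarrow> (\<forall>i. 1 < s $ i * rho K (n i) i f)"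
    if "s \<in> pos_orthant" for s
    using that f by (auto simp: window_def odot_in_paths rho_odot[OF _ n1] pos_orthant_def)
  show ?thesis
  proof (cases "\<forall>i. 0 < rho K (n i) i f")
    case True
    let ?x = "\<chi> i. inverse (rho K (n i) i f)"
    have "(\<integral>\<^sup>+ s. indicator (window K n 1) (s \<odot> f) \<partial>theta \<alpha>) =
        (\<integral>\<^sup>+ s. indicator {s. \<forall>i. ?x $ i < s $ i} s \<partial>theta \<alpha>)"
    proof (rule nn_integral_cong_AE, rule AE_mp[OF AE_theta_pos_orthant[OF alpha]], rule AE_I2, rule impI)
      fix s :: "real ^ 'q" assume "s \<in> pos_orthant"
      then show "indicator (window K n 1) (s \<odot> f) = (indicator {s. \<forall>i. ?x $ i < s $ i} s :: ennreal)"
        using True by (simp add: indicator_def window_iff inverse_eq_divide pos_divide_less_eq)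
    qed
    also have "\<dots> = emeasure (theta \<alpha>) {s. \<forall>i. ?x $ i < s $ i}" by (subst nn_integral_indicator) simp_all
    also have "\<dots> = ennreal (\<Prod>i\<in>UNIV. ?x $ i powr (- \<alpha> $ i))"
      by (rule emeasure_theta_orthant[OF alpha]) (use True in \<open>simp add: pos_orthant_def\<close>)
    finally show ?thesis using True by (simp add: inverse_powr powr_minus)
  next
    case False
    \<comment> \<open>A coordinate that vanishes on its level keeps every scaled path out of the
      window. Since \<open>0 powr x = 0\<close>, the right-hand side vanishes as well.\<close>
    then obtain i where i: "rho K (n i) i f = 0"
      using rho_nonneg[OF f n1] by (meson linorder_not_less order_antisym)
    have "(\<integral>\<^sup>+ s. indicator (window K n 1) (s \<odot> f) \<partial>theta \<alpha>) = (\<integral>\<^sup>+ s. 0 \<partial>theta \<alpha>)"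
    proof (rule nn_integral_cong_AE, rule AE_mp[OF AE_theta_pos_orthant[OF alpha]], rule AE_I2, rule impI)
      fix s :: "real ^ 'q" assume "s \<in> pos_orthant"
      moreover have "\<not> 1 < s $ i * rho K (n i) i f" using i by simp
      ultimately show "indicator (window K n 1) (s \<odot> f) = (0 :: ennreal)" using window_iff by fastforce
    qed
    moreover have "(\<Prod>i\<in>UNIV. rho K (n i) i f powr \<alpha> $ i) = 0"
      using i by (intro prod_zero bexI[of _ i]) simp_all
    ultimately show ?thesis by (simp only: nn_integral_const ennreal_0 mult_zero_left)
  qed
qed

text \<open>Only the vanishing pattern of the coordinates enters, not their size, so the value is
  constant along scaling orbits. For a path outside \<open>paths0\<close> no level qualifies and the
  value carries no information.\<close>

definition first_level :: "('t \<Rightarrow> real ^ 'q) \<Rightarrow> nat" where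
  "first_level f = (LEAST m. \<forall>i. 0 < rho K (Suc m) i f)"

definition level :: "'q \<Rightarrow> ('t \<Rightarrow> real ^ 'q) \<Rightarrow> real" where
  "level i f = rho K (Suc (first_level f)) i f"

lemma level_pos:
  assumes "f \<in> paths0"
  shows "0 < level i f"
proof -
  have "\<exists>m. \<forall>i. 0 < rho K (Suc m) i f" using assms mem_paths0_iff by blast
  from LeastI_ex[OF this] show ?thesis unfolding level_def first_level_def by blast
qed

lemma first_level_odot:
  assumes "f \<in> paths" "r \<in> pos_orthant"
  shows "first_level (r \<odot> f) = first_level f"
proof -
  have "0 < r $ i * x \<longleftrightarrow> 0 < x" for i x
    using assms(2) unfolding pos_orthant_def by (metis mem_Collect_eq mult_pos_pos zero_less_mult_pos)
  then show ?thesis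
    unfolding first_level_def using assms by (simp add: rho_odot pos_orthant_def)
qed

lemma level_odot:
  assumes "f \<in> paths" "r \<in> pos_orthant"
  shows "level i (r \<odot> f) = r $ i * level i f"
  using assms by (simp add: level_def first_level_odot rho_odot pos_orthant_def)

lemma measurable_first_level [measurable]:
  "first_level \<in> (path_borel :: ('t \<Rightarrow> real ^ 'q) measure) \<rightarrow>\<^sub>M count_space UNIV"
  unfolding first_level_def by measurable

text \<open>\<open>first_level\<close> takes countably many values, and with its value held fixed
  \<open>level\<close> is an ordinary sup-norm.\<close>

lemma measurable_level [measurable]:
  "level i \<in> borel_measurable (path_borel :: ('t \<Rightarrow> real ^ 'q) measure)"
  unfolding level_def
  by (rule measurable_compose_countable[OF _ measurable_first_level]) measurable

end

section \<open>Homogeneity, sigma-finiteness and disintegration of a tail measure\<close>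

locale tail_measure = index_exhaustion K
  for K :: "nat \<Rightarrow> 't::topological_space set" +
  fixes \<alpha> :: "real ^ 'q" and \<nu> :: "('t \<Rightarrow> real ^ 'q) measure"
  assumes alpha: "\<forall>i. 0 < \<alpha> $ i"
    and tail: "multihomogeneous_tail_measure K \<alpha> \<nu>"
begin

lemma sets_nu [simp, measurable_cong]: "sets \<nu> = sets path_borel"
  using tail by (simp add: multihomogeneous_tail_measure_def)

lemma space_nu [simp]: "space \<nu> = paths"
  using sets_eq_imp_space_eq[OF sets_nu] by simp

text \<open>A preimage under scaling by r is an image under scaling by the inverse of r.
  Homogeneity, stated for images, therefore yields \<open>chi_pow\<close> itself and not its
  reciprocal.\<close>

lemma distr_scale:
  assumes r: "r \<in> pos_orthant"
  shows "distr \<nu> path_borel (\<lambda>f. r \<odot> f) = scale_measure (ennreal (chi_pow \<alpha> r)) \<nu>"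
proof (rule measure_eqI)
  fix A assume "A \<in> sets (distr \<nu> path_borel (\<lambda>f. r \<odot> f))"
  then have [measurable]: "A \<in> sets path_borel" by simp
  have "(\<lambda>f. r \<odot> f) -` A \<inter> space \<nu> = (\<lambda>f. vec_inverse r \<odot> f) ` A"
  proof (intro equalityI subsetI)
    fix f assume "f \<in> (\<lambda>f. r \<odot> f) -` A \<inter> space \<nu>"
    then show "f \<in> (\<lambda>f. vec_inverse r \<odot> f) ` A"
      by (intro image_eqI[of _ _ "r \<odot> f"]) (simp_all add: vec_inverse_odot_cancel[OF r])
  next
    fix f assume "f \<in> (\<lambda>f. vec_inverse r \<odot> f) ` A"
    then obtain g where g: "g \<in> A" "f = vec_inverse r \<odot> g" by blast
    have "g \<in> paths" using g(1) sets.sets_into_space[of A path_borel] by auto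
    with g show "f \<in> (\<lambda>f. r \<odot> f) -` A \<inter> space \<nu>"
      by (simp add: vec_inverse_odot_cancel[OF r] odot_in_paths)
  qed
  then have "emeasure (distr \<nu> path_borel (\<lambda>f. r \<odot> f)) A = emeasure \<nu> ((\<lambda>f. vec_inverse r \<odot> f) ` A)"
    by (simp add: emeasure_distr)
  also have "\<dots> = ennreal (chi_pow \<alpha> r) * emeasure \<nu> A"
    using tail vec_inverse_pos_orthant[OF r] \<open>A \<in> sets path_borel\<close>
    by (simp add: multihomogeneous_tail_measure_def chi_pow_vec_inverse)
  finally show "emeasure (distr \<nu> path_borel (\<lambda>f. r \<odot> f)) A =
    emeasure (scale_measure (ennreal (chi_pow \<alpha> r)) \<nu>) A" by simp
qed simp

lemma nn_integral_scale:
  assumes "r \<in> pos_orthant" and [measurable]: "F \<in> borel_measurable path_borel"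
  shows "(\<integral>\<^sup>+ f. F (r \<odot> f) \<partial>\<nu>) = ennreal (chi_pow \<alpha> r) * (\<integral>\<^sup>+ f. F f \<partial>\<nu>)"
proof -
  have "(\<integral>\<^sup>+ f. F (r \<odot> f) \<partial>\<nu>) = (\<integral>\<^sup>+ f. F f \<partial>distr \<nu> path_borel (\<lambda>f. r \<odot> f))"
    by (simp add: nn_integral_distr)
  then show ?thesis unfolding distr_scale[OF assms(1)] by (simp add: nn_integral_scale_measure)
qed

lemma window_finite:
  assumes n: "n \<in> pos_indices" and e: "\<epsilon> \<in> pos_orthant"
  shows "emeasure \<nu> (window K n \<epsilon>) < \<infinity>"
proof -
  have n1: "1 \<le> n i" for i using n by (simp add: pos_indices_def)
  have "vec_inverse \<epsilon> \<odot> f \<in> window K n 1 \<longleftrightarrow> f \<in> window K n \<epsilon>" if "f \<in> paths" for f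
    using that e vec_inverse_pos_orthant[OF e]
    by (simp add: window_def odot_in_paths rho_odot[OF _ n1] pos_orthant_def)
      (simp add: vec_inverse_def inverse_eq_divide less_divide_eq)
  then have "emeasure \<nu> (window K n \<epsilon>) = emeasure (distr \<nu> path_borel (\<lambda>f. vec_inverse \<epsilon> \<odot> f)) (window K n 1)"
    by (subst emeasure_distr)
      (auto intro!: arg_cong[where f = "emeasure \<nu>"] sets_window n, auto simp: window_def)
  also have "\<dots> < \<infinity>"
    unfolding distr_scale[OF vec_inverse_pos_orthant[OF e]]
    using tail n by (simp add: multihomogeneous_tail_measure_def ennreal_mult_less_top)
  finally show ?thesis .
qed

lemma AE_paths0: "AE f in \<nu>. f \<in> paths0"
proof (rule AE_I)
  show "{f \<in> space \<nu>. f \<notin> paths0} \<subseteq> D_Pi" by (auto simp: paths0_def)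
  show "emeasure \<nu> D_Pi = 0" using tail by (simp add: multihomogeneous_tail_measure_def)
  have "D_Pi = space path_borel - (paths0 :: ('t \<Rightarrow> real ^ 'q) set)"
    by (auto simp: paths0_def D_Pi_def)
  then show "D_Pi \<in> sets \<nu>"
    using sets.compl_sets[OF sets_paths0] unfolding sets_nu by metis
qed

text \<open>Windows with rising level and threshold falling to zero exhaust \<open>paths0\<close>,
  and the rest of the space is a null set.\<close>

lemma sigma_finite: "sigma_finite_measure \<nu>"
proof
  let ?V = "\<lambda>k. window K (\<lambda>_. Suc k) (\<chi> i. inverse (real (Suc k))) :: ('t \<Rightarrow> real ^ 'q) set"
  have V: "?V k \<in> sets path_borel" "emeasure \<nu> (?V k) \<noteq> \<infinity>" for k
    using window_finite[of "\<lambda>_. Suc k" "\<chi> i. inverse (real (Suc k))"]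
    by (auto simp: pos_indices_def pos_orthant_def intro!: sets_window)
  have P: "paths - paths0 \<in> sets (path_borel :: ('t \<Rightarrow> real ^ 'q) measure)"
    using sets.compl_sets[OF sets_paths0] space_path_borel by metis
  have "emeasure \<nu> (paths - paths0) = 0"
    using AE_paths0 P AE_iff_measurable[of "paths - paths0" \<nu> "\<lambda>f. f \<in> paths0"] by auto
  moreover have "f \<in> (\<Union>k. ?V k)" if f: "f \<in> paths0" for f
  proof -
    obtain m where m: "f \<in> paths" "\<forall>i. 0 < rho K (Suc m) i f" using f unfolding mem_paths0_iff by blast
    have "\<forall>i. \<exists>k. inverse (real (Suc k)) < rho K (Suc m) i f" using m(2) reals_Archimedean by blast
    then obtain k where k: "\<And>i. inverse (real (Suc (k i))) < rho K (Suc m) i f" by metis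
    \<comment> \<open>One index has to serve as level and as threshold for all coordinates;
      enlarging it only weakens both requirements.\<close>
    define l where "l = max m (Max (range k))"
    have "inverse (real (Suc l)) < rho K (Suc l) i f" for i
    proof -
      have "k i \<le> l" by (simp add: l_def le_max_iff_disj)
      then have "inverse (real (Suc l)) \<le> inverse (real (Suc (k i)))" by simp
      also note k
      also have "rho K (Suc m) i f \<le> rho K (Suc l) i f"
        using rho_mono[OF m(1)] by (simp add: l_def)
      finally show ?thesis .
    qed
    then show ?thesis using m(1) by (auto simp: window_def)
  qed
  moreover have "?V k \<subseteq> paths" "paths0 \<subseteq> paths" for k by (auto simp: window_def paths0_def)
  ultimately show "\<exists>A. countable A \<and> A \<subseteq> sets \<nu> \<and> \<Union>A = space \<nu> \<and> (\<forall>a\<in>A. emeasure \<nu> a \<noteq> \<infinity>)"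
    using V P by (intro exI[of _ "insert (paths - paths0) (range ?V)"]) auto
qed

text \<open>The disintegration asks that
  \<open>chi_pow \<alpha> s * weight (vec_inverse s \<odot> f)\<close> have
  \<open>theta\<close>-integral 1 in s. The indicators confine the paths with a given
  \<open>first_level\<close> to a window, hence to finite mass.\<close>

definition weight :: "('t \<Rightarrow> real ^ 'q) \<Rightarrow> ennreal" where
  "weight f = (\<Prod>i\<in>UNIV. ennreal (level i f powr (- \<alpha> $ i)) * indicator {1<..} (level i f))"

lemma measurable_weight [measurable]: "weight \<in> borel_measurable path_borel"
  unfolding weight_def by measurable

text \<open>The weight picks, on every scaling orbit, a share of \<open>\<nu>\<close> whose \<open>\<theta>\<close>-average along the orbit
  is one; exchanging the integrals moves the scaling from \<open>A\<close> to the weight.\<close>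

lemma emeasure_disintegration:
  assumes [measurable]: "A \<in> sets path_borel"
  shows "emeasure \<nu> A = (\<integral>\<^sup>+ f. weight f * (\<integral>\<^sup>+ s. indicator A (s \<odot> f) \<partial>theta \<alpha>) \<partial>\<nu>)"
proof -
  interpret nu: sigma_finite_measure \<nu> by (rule sigma_finite)
  interpret theta: sigma_finite_measure "theta \<alpha>" by (rule sigma_finite_theta[OF alpha])
  interpret pair: pair_sigma_finite \<nu> "theta \<alpha>" ..
  \<comment> \<open>For positive s and f in \<open>paths0\<close> this is
    \<open>chi_pow \<alpha> s * weight (vec_inverse s \<odot> f)\<close> written out: one power of s
    comes from \<open>chi_pow\<close>, the other from the level divided by s. The product form
    permits factorwise integration.\<close>
  define k where "k s f = (\<Prod>i\<in>UNIV. ennreal (s $ i powr \<alpha> $ i * s $ i powr \<alpha> $ i * level i f powr (- \<alpha> $ i)) *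
      indicator {..<level i f} (s $ i))" for s :: "real ^ 'q" and f :: "'t \<Rightarrow> real ^ 'q"
  have [measurable]: "Measurable.pred (path_borel \<Otimes>\<^sub>M borel)
      (\<lambda>p. snd p $ i \<in> {..<level i (fst p)})" for i :: 'q
    unfolding lessThan_iff by measurable
  have [measurable]: "(\<lambda>(f, s). k s f) \<in> borel_measurable (\<nu> \<Otimes>\<^sub>M theta \<alpha>)"
    unfolding k_def by measurable
  have k_one: "(\<integral>\<^sup>+ s. k s f \<partial>theta \<alpha>) = 1" if "f \<in> paths0" for f
    unfolding k_def using alpha level_pos[OF that]
    by (subst nn_integral_theta_prod[where h = "\<lambda>i s. ennreal (s powr \<alpha> $ i * s powr \<alpha> $ i *
        level i f powr (- \<alpha> $ i)) * indicator {..<level i f} s"])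
      (simp_all add: nn_integral_pareto_reciprocal)
  have inner: "(\<integral>\<^sup>+ f. weight f * indicator A (s \<odot> f) \<partial>\<nu>) = (\<integral>\<^sup>+ f. k s f * indicator A f \<partial>\<nu>)"
    if s: "s \<in> pos_orthant" for s
  proof -
    \<comment> \<open>\<open>?H\<close> is arranged so that the integrand becomes
      \<open>?H (s \<odot> f)\<close>; \<open>nn_integral_scale\<close> then removes the scaling
      from the argument of the indicator.\<close>
    let ?H = "\<lambda>f. weight (vec_inverse s \<odot> f) * indicator A f"
    have "(\<integral>\<^sup>+ f. weight f * indicator A (s \<odot> f) \<partial>\<nu>) = (\<integral>\<^sup>+ f. ?H (s \<odot> f) \<partial>\<nu>)"
      by (simp add: vec_inverse_odot_cancel[OF s])
    also have "\<dots> = ennreal (chi_pow \<alpha> s) * (\<integral>\<^sup>+ f. ?H f \<partial>\<nu>)"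
      by (rule nn_integral_scale[OF s]) measurable
    also have "\<dots> = (\<integral>\<^sup>+ f. ennreal (chi_pow \<alpha> s) * ?H f \<partial>\<nu>)"
      by (rule nn_integral_cmult[symmetric]) measurable
    also have "\<dots> = (\<integral>\<^sup>+ f. k s f * indicator A f \<partial>\<nu>)"
    proof (rule nn_integral_cong_AE, rule AE_mp[OF AE_paths0], rule AE_I2, rule impI)
      fix f :: "'t \<Rightarrow> real ^ 'q" assume f: "f \<in> paths0"
      have chi: "ennreal (chi_pow \<alpha> s) = (\<Prod>i\<in>UNIV. ennreal (s $ i powr \<alpha> $ i))"
        by (simp add: chi_pow_def prod_ennreal)
      have "ennreal (s $ i powr \<alpha> $ i) * (ennreal (level i (vec_inverse s \<odot> f) powr (- \<alpha> $ i)) *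
            indicator {1<..} (level i (vec_inverse s \<odot> f))) =
          ennreal (s $ i powr \<alpha> $ i * s $ i powr \<alpha> $ i * level i f powr (- \<alpha> $ i)) *
            indicator {..<level i f} (s $ i)" for i
      proof -
        have si: "0 < s $ i" using s by (simp add: pos_orthant_def)
        have "f \<in> paths" using f by (simp add: paths0_def)
        then have l: "level i (vec_inverse s \<odot> f) = level i f / s $ i"
          by (subst level_odot[OF _ vec_inverse_pos_orthant[OF s]]) (simp_all add: vec_inverse_def field_simps)
        have "(level i f / s $ i) powr (- \<alpha> $ i) = s $ i powr \<alpha> $ i * level i f powr (- \<alpha> $ i)"
          using si level_pos[OF f, of i] by (simp add: powr_divide powr_minus field_simps)
        then show ?thesis unfolding l using si
          by (simp add: indicator_def less_divide_eq mult.assoc[symmetric] ennreal_mult[symmetric])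
      qed
      then have "ennreal (chi_pow \<alpha> s) * weight (vec_inverse s \<odot> f) = k s f"
        unfolding chi weight_def k_def prod.distrib[symmetric] by simp
      then show "ennreal (chi_pow \<alpha> s) * ?H f = k s f * indicator A f"
        by (simp add: mult.assoc[symmetric])
    qed
    finally show ?thesis .
  qed
  have "(\<integral>\<^sup>+ f. weight f * (\<integral>\<^sup>+ s. indicator A (s \<odot> f) \<partial>theta \<alpha>) \<partial>\<nu>) =
      (\<integral>\<^sup>+ f. (\<integral>\<^sup>+ s. weight f * indicator A (s \<odot> f) \<partial>theta \<alpha>) \<partial>\<nu>)"
    by (intro nn_integral_cong nn_integral_cmult[symmetric]) simp
  also have "\<dots> = (\<integral>\<^sup>+ s. (\<integral>\<^sup>+ f. weight f * indicator A (s \<odot> f) \<partial>\<nu>) \<partial>theta \<alpha>)"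
    by (rule pair.Fubini'[symmetric]) measurable
  also have "\<dots> = (\<integral>\<^sup>+ s. (\<integral>\<^sup>+ f. k s f * indicator A f \<partial>\<nu>) \<partial>theta \<alpha>)"
    using AE_theta_pos_orthant[OF alpha] inner by (intro nn_integral_cong_AE) auto
  also have "\<dots> = (\<integral>\<^sup>+ f. (\<integral>\<^sup>+ s. k s f * indicator A f \<partial>theta \<alpha>) \<partial>\<nu>)"
    by (rule pair.Fubini') measurable
  also have "\<dots> = (\<integral>\<^sup>+ f. indicator A f \<partial>\<nu>)"
  proof (rule nn_integral_cong_AE, rule AE_mp[OF AE_paths0], rule AE_I2, rule impI)
    fix f :: "'t \<Rightarrow> real ^ 'q" assume f: "f \<in> space \<nu>" "f \<in> paths0"
    have "(\<lambda>s. k s f) \<in> borel_measurable (theta \<alpha>)"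
      unfolding k_def by measurable
    then show "(\<integral>\<^sup>+ s. k s f * indicator A f \<partial>theta \<alpha>) = indicator A f"
      using k_one[OF f(2)] by (simp add: nn_integral_multc)
  qed
  finally show ?thesis by simp
qed

end

section \<open>Construction of a representer\<close>

context tail_measure
begin

text \<open>Any probability density proportional to \<open>weight\<close> up to an orbit-invariant factor becomes a
  representer after rescaling along the orbits; the factor only has to make the mass finite.\<close>

lemma representer_exists:
  "\<exists>(M :: ('t \<Rightarrow> real ^ 'q) measure) Z. representer K \<alpha> \<nu> M Z \<and>
    (\<forall>S\<in>sets path_borel. (\<forall>r\<in>pos_orthant. \<forall>f\<in>S. r \<odot> f \<in> S) \<and> emeasure \<nu> (paths - S) = 0 \<longrightarrow>
      (AE f in M. Z f \<in> S))"
proof -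
  define V where "V k = (window K (\<lambda>_. Suc k) 1 :: ('t \<Rightarrow> real ^ 'q) set)" for k
  \<comment> \<open>Geometric weights divided by the window masses make the sum of
    \<open>a k * emeasure \<nu> (V k)\<close> finite; the added 1 keeps the denominator
    positive.\<close>
  define a where "a k = (1 / 2) ^ k / (1 + measure \<nu> (V k))" for k
  \<comment> \<open>On \<open>paths0\<close> this is \<open>weight\<close> times the factor
    \<open>P\<close> introduced below. The powers of the level are dropped here and restored by the
    rescaling \<open>c\<close>.\<close>
  define \<phi> where "\<phi> f = ennreal (a (first_level f)) * (\<Prod>i\<in>UNIV. indicator {1<..} (level i f))"
    for f :: "'t \<Rightarrow> real ^ 'q"
  have a_pos: "0 < a k" for k unfolding a_def by (simp add: add_pos_nonneg)
  have V: "V k \<in> sets path_borel" "emeasure \<nu> (V k) < \<infinity>" for k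
    using sets_window[of "\<lambda>_. Suc k" 1] window_finite[of "\<lambda>_. Suc k" 1]
    unfolding V_def by (simp_all add: pos_indices_def pos_orthant_def)
  note [measurable] = V(1)
  have [measurable]: "\<phi> \<in> borel_measurable path_borel" unfolding \<phi>_def by measurable

  \<comment> \<open>A path with nonzero \<open>\<phi>\<close> lies in the window of its own first
    level, so a single term of the series already equals \<open>\<phi> f\<close>.\<close>
  have phi_le: "\<phi> f \<le> (\<Sum>k. ennreal (a k) * indicator (V k) f)" if f: "f \<in> paths" for f
  proof (cases "\<forall>i. 1 < level i f")
    case True
    then have "f \<in> V (first_level f)" using f by (simp add: V_def window_def level_def)
    then have "\<phi> f = (\<Sum>k\<in>{first_level f}. ennreal (a k) * indicator (V k) f)"
      using True by (simp add: \<phi>_def)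
    also have "\<dots> \<le> (\<Sum>k. ennreal (a k) * indicator (V k) f)"
      by (rule sum_le_suminf) (auto intro: summableI)
    finally show ?thesis .
  qed (auto simp: \<phi>_def prod_indicator)
  have term_le: "ennreal (a k) * emeasure \<nu> (V k) \<le> ennreal ((1 / 2) ^ k)" for k
  proof -
    have "emeasure \<nu> (V k) = ennreal (measure \<nu> (V k))"
      using V(2)[of k] by (intro emeasure_eq_ennreal_measure) auto
    moreover have "a k * measure \<nu> (V k) \<le> (1 / 2) ^ k"
      unfolding a_def by (simp add: divide_simps add_pos_nonneg mult_left_mono) 
    ultimately show ?thesis using a_pos[of k]
      by (simp add: ennreal_mult[symmetric] less_imp_le ennreal_leI)
  qed
  have "(\<integral>\<^sup>+ f. \<phi> f \<partial>\<nu>) \<le> (\<integral>\<^sup>+ f. (\<Sum>k. ennreal (a k) * indicator (V k) f) \<partial>\<nu>)"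
    using phi_le by (intro nn_integral_mono) simp
  also have "\<dots> = (\<Sum>k. ennreal (a k) * emeasure \<nu> (V k))"
    by (subst nn_integral_suminf) (simp_all add: nn_integral_cmult)
  also have "\<dots> \<le> (\<Sum>k. ennreal ((1 / 2) ^ k))"
    by (intro suminf_le term_le summableI)
  also have "\<dots> < \<infinity>" by (subst suminf_ennreal2) (simp_all add: summable_geometric)
  finally have phi_finite: "(\<integral>\<^sup>+ f. \<phi> f \<partial>\<nu>) < \<infinity>" .
  \<comment> \<open>If \<open>\<phi>\<close> vanished almost everywhere, so would
    \<open>weight\<close>, and the disintegration would make \<nu> the zero measure.\<close>
  have phi_nonzero: "(\<integral>\<^sup>+ f. \<phi> f \<partial>\<nu>) \<noteq> 0"
  proof
    assume "(\<integral>\<^sup>+ f. \<phi> f \<partial>\<nu>) = 0"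
    then have "AE f in \<nu>. \<phi> f = 0" by (subst (asm) nn_integral_0_iff_AE) simp_all
    then have "AE f in \<nu>. weight f = 0"
    proof (rule AE_mp, intro AE_I2 impI)
      fix f assume "\<phi> f = 0"
      then have "(\<Prod>i\<in>UNIV. indicator {1<..} (level i f)) = (0 :: ennreal)"
        using a_pos[of "first_level f"] by (simp add: \<phi>_def)
      then show "weight f = 0" by (auto simp: weight_def prod.distrib)
    qed
    then have "(\<integral>\<^sup>+ f. weight f * (\<integral>\<^sup>+ s. indicator paths (s \<odot> f) \<partial>theta \<alpha>) \<partial>\<nu>) = (\<integral>\<^sup>+ f. 0 \<partial>\<nu>)"
      by (intro nn_integral_cong_AE) auto
    then have "emeasure \<nu> paths = 0"
      using emeasure_disintegration[of paths] sets.top[of "path_borel :: ('t \<Rightarrow> real ^ 'q) measure"] by simp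
    then show False using tail by (simp add: multihomogeneous_tail_measure_def)
  qed

  define C where "C = enn2real (\<integral>\<^sup>+ f. \<phi> f \<partial>\<nu>)"
  have C: "(\<integral>\<^sup>+ f. \<phi> f \<partial>\<nu>) = ennreal C" "0 < C"
    using phi_finite phi_nonzero unfolding C_def
    by (auto simp: enn2real_positive_iff less_top zero_less_iff_neq_zero)
  define P where "P f = a (first_level f) * (\<Prod>i\<in>UNIV. level i f powr \<alpha> $ i)" for f
  \<comment> \<open>Chosen to give \<open>chi_pow \<alpha> (c f) = C / P f\<close>: the exponent
    1/\<alpha>_i undoes the power in \<open>chi_pow\<close>, and each of the q coordinates
    contributes a q-th root.\<close>
  define c where "c f = (\<chi> i. (C / P f) powr (1 / (real CARD('q) * \<alpha> $ i)))" for f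
  \<comment> \<open>Restricting to \<open>paths0\<close> makes Z take values in
    \<open>paths0\<close> everywhere and not merely almost everywhere.\<close>
  define M where "M = density (restrict_space \<nu> paths0) (\<lambda>f. ennreal (1 / C) * \<phi> f)"
  define Z where "Z f = c f \<odot> f" for f
  have [measurable]: "(\<lambda>f. a (first_level f)) \<in> borel_measurable path_borel"
    by (rule measurable_compose[OF measurable_first_level]) simp
  have [measurable]: "c \<in> borel_measurable path_borel" unfolding c_def P_def by measurable
  have Z_path [measurable]: "Z \<in> path_borel \<rightarrow>\<^sub>M path_borel" unfolding Z_def by measurable
  have P_pos: "0 < P f" if "f \<in> paths0" for f
    unfolding P_def using a_pos level_pos[OF that] by (auto intro!: mult_pos_pos prod_pos simp: less_imp_neq[symmetric])
  have c_pos: "c f \<in> pos_orthant" if "f \<in> paths0" for f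
    using P_pos[OF that] C(2) by (simp add: c_def pos_orthant_def)
  have chi_c: "chi_pow \<alpha> (c f) = C / P f" if "f \<in> paths0" for f
  proof -
    have root: "(x powr (1 / real CARD('q))) powr real CARD('q) = x" if "0 < x" for x
      using that by (simp add: powr_powr)
    have x: "0 < C / P f" using P_pos[OF that] C(2) by simp
    have "chi_pow \<alpha> (c f) = (\<Prod>i\<in>(UNIV :: 'q set). (C / P f) powr (1 / real CARD('q)))"
      unfolding chi_pow_def c_def using alpha
      by (intro prod.cong refl) (simp add: powr_powr less_imp_neq[symmetric])
    also have "\<dots> = ((C / P f) powr (1 / real CARD('q))) powr real CARD('q)"
      by (subst powr_realpow) (use x in auto)
    also have "\<dots> = C / P f" by (rule root[OF x])
    finally show ?thesis .
  qed
  have paths0_space: "paths0 \<inter> space \<nu> \<in> sets \<nu>"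
    using sets_paths0_Int_space by simp
  have space_M: "space M = paths0" unfolding M_def by (auto simp: space_restrict_space paths0_def)
  have sets_M: "sets M = sets path0_borel"
    unfolding M_def by (simp add: sets_restrict_space)
  have meas_M: "F \<in> borel_measurable M" if "F \<in> borel_measurable path_borel"
    for F :: "('t \<Rightarrow> real ^ 'q) \<Rightarrow> ennreal"
    using measurable_restrict_space1[OF that] measurable_cong_sets[OF sets_M refl] by blast
  have integral_M: "(\<integral>\<^sup>+ f. F f \<partial>M) = (\<integral>\<^sup>+ f. ennreal (1 / C) * \<phi> f * F f \<partial>\<nu>)"
    if [measurable]: "F \<in> borel_measurable path_borel" for F
  proof -
    have [measurable]: "F \<in> borel_measurable (restrict_space \<nu> paths0)"
      "\<phi> \<in> borel_measurable (restrict_space \<nu> paths0)"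
      by (auto intro!: measurable_restrict_space1)
    have "(\<integral>\<^sup>+ f. F f \<partial>M) = (\<integral>\<^sup>+ f. ennreal (1 / C) * \<phi> f * F f \<partial>restrict_space \<nu> paths0)"
      unfolding M_def by (subst nn_integral_density) simp_all
    also have "\<dots> = (\<integral>\<^sup>+ f. ennreal (1 / C) * \<phi> f * F f * indicator paths0 f \<partial>\<nu>)"
      by (rule nn_integral_restrict_space[OF paths0_space])
    also have "\<dots> = (\<integral>\<^sup>+ f. ennreal (1 / C) * \<phi> f * F f \<partial>\<nu>)"
      using AE_paths0 by (intro nn_integral_cong_AE) auto
    finally show ?thesis .
  qed
  have "emeasure M (space M) = (\<integral>\<^sup>+ f. 1 \<partial>M)" by simp
  also have "\<dots> = ennreal (1 / C) * ennreal C"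
    by (subst integral_M) (simp_all add: nn_integral_cmult C(1))
  also have "\<dots> = 1" using C(2) by (simp add: ennreal_mult[symmetric])
  finally have prob: "prob_space M" by (rule prob_spaceI)
  have Z_M: "Z \<in> M \<rightarrow>\<^sub>M path_borel"
    using measurable_restrict_space1[OF Z_path] measurable_cong_sets[OF sets_M refl] by blast
  have Z_M0: "Z \<in> M \<rightarrow>\<^sub>M path0_borel"
    using Z_M by (rule measurable_restrict_space2[rotated])
      (use c_pos in \<open>auto simp: space_M Z_def odot_in_paths0_iff\<close>)

  have nu_eq: "nu_of \<alpha> M Z = \<nu>"
  proof (rule measure_eqI)
    show sets: "sets (nu_of \<alpha> M Z) = sets \<nu>"
      unfolding nu_of_eq_distr[OF alpha Z_M] by simp
    fix A assume "A \<in> sets (nu_of \<alpha> M Z)"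
    then have [measurable]: "A \<in> sets path_borel" using sets by simp
    interpret theta: sigma_finite_measure "theta \<alpha>" by (rule sigma_finite_theta[OF alpha])
    have [measurable]: "(\<lambda>f. \<integral>\<^sup>+ s. indicator A (s \<odot> Z f) \<partial>theta \<alpha>) \<in> borel_measurable path_borel"
      by measurable
    have "emeasure (nu_of \<alpha> M Z) A = (\<integral>\<^sup>+ f. (\<integral>\<^sup>+ s. indicator A (s \<odot> Z f) \<partial>theta \<alpha>) \<partial>M)"
      by (rule emeasure_nu_of[OF alpha Z_M]) simp
    also have "\<dots> = (\<integral>\<^sup>+ f. ennreal (1 / C) * \<phi> f * (\<integral>\<^sup>+ s. indicator A (s \<odot> Z f) \<partial>theta \<alpha>) \<partial>\<nu>)"
      by (rule integral_M) measurable
    also have "\<dots> = (\<integral>\<^sup>+ f. weight f * (\<integral>\<^sup>+ s. indicator A (s \<odot> f) \<partial>theta \<alpha>) \<partial>\<nu>)"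
    \<comment> \<open>Replacing \<open>Z f\<close> by f costs the constant
      \<open>chi_pow \<alpha> (c f)\<close> on each orbit. It remains to see that
      \<open>\<phi> f / C\<close> times \<open>C / P f\<close> is \<open>weight f\<close>.\<close>
    proof (rule nn_integral_cong_AE, rule AE_mp[OF AE_paths0], rule AE_I2, rule impI)
      fix f :: "'t \<Rightarrow> real ^ 'q" assume f: "f \<in> space \<nu>" "f \<in> paths0"
      have "(\<integral>\<^sup>+ s. indicator A (s \<odot> Z f) \<partial>theta \<alpha>) =
          (\<integral>\<^sup>+ s. indicator A ((\<chi> i. c f $ i * s $ i) \<odot> f) \<partial>theta \<alpha>)"
        unfolding Z_def odot_odot by (simp only: mult.commute)
      also have "\<dots> = ennreal (chi_pow \<alpha> (c f)) * (\<integral>\<^sup>+ s. indicator A (s \<odot> f) \<partial>theta \<alpha>)"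
        using f(1) by (intro nn_integral_theta_scale[OF c_pos[OF f(2)] alpha]) simp
      finally have scale: "(\<integral>\<^sup>+ s. indicator A (s \<odot> Z f) \<partial>theta \<alpha>) =
          ennreal (C / P f) * (\<integral>\<^sup>+ s. indicator A (s \<odot> f) \<partial>theta \<alpha>)"
        unfolding chi_c[OF f(2)] .
      have "1 / C * a (first_level f) * (C / P f) = (\<Prod>i\<in>UNIV. level i f powr (- \<alpha> $ i))"
        using C(2) a_pos[of "first_level f"] unfolding P_def
        by (simp add: powr_minus prod_inversef inverse_eq_divide prod_dividef)
      then have "ennreal (1 / C) * ennreal (a (first_level f)) * ennreal (C / P f) =
          (\<Prod>i\<in>UNIV. ennreal (level i f powr (- \<alpha> $ i)))"
        using C(2) a_pos[of "first_level f"] P_pos[OF f(2)]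
        by (simp add: ennreal_mult[symmetric] prod_ennreal less_imp_le)
      moreover have "ennreal (1 / C) * \<phi> f * ennreal (C / P f) =
          (ennreal (1 / C) * ennreal (a (first_level f)) * ennreal (C / P f)) *
          (\<Prod>i\<in>UNIV. indicator {1<..} (level i f))"
        unfolding \<phi>_def by (simp add: mult_ac)
      ultimately have "ennreal (1 / C) * \<phi> f * ennreal (C / P f) = weight f"
        unfolding weight_def prod.distrib by simp
      then show "ennreal (1 / C) * \<phi> f * (\<integral>\<^sup>+ s. indicator A (s \<odot> Z f) \<partial>theta \<alpha>) =
          weight f * (\<integral>\<^sup>+ s. indicator A (s \<odot> f) \<partial>theta \<alpha>)"
        unfolding scale by (simp add: mult.assoc[symmetric])
    qed
    also have "\<dots> = emeasure \<nu> A" by (rule emeasure_disintegration[symmetric]) simp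
    finally show "emeasure (nu_of \<alpha> M Z) A = emeasure \<nu> A" .
  qed

  have moments: "(\<integral>\<^sup>+ f. ennreal (\<Prod>i\<in>UNIV. rho K (n i) i (Z f) powr \<alpha> $ i) \<partial>M) < \<infinity>"
    if n: "n \<in> pos_indices" for n
  proof -
    have "Z f \<in> paths" if "f \<in> space M" for f using measurable_space[OF Z_M that] by simp
    then have "(\<integral>\<^sup>+ f. ennreal (\<Prod>i\<in>UNIV. rho K (n i) i (Z f) powr \<alpha> $ i) \<partial>M) =
        (\<integral>\<^sup>+ f. (\<integral>\<^sup>+ s. indicator (window K n 1) (s \<odot> Z f) \<partial>theta \<alpha>) \<partial>M)"
      by (intro nn_integral_cong nn_integral_theta_window[symmetric] alpha n)
    also have "\<dots> = emeasure \<nu> (window K n 1)"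
      unfolding nu_eq[symmetric] by (rule emeasure_nu_of[OF alpha Z_M sets_window[OF n], symmetric])
    also have "\<dots> < \<infinity>" using tail n by (simp add: multihomogeneous_tail_measure_def)
    finally show ?thesis .
  qed
  have rep: "representer K \<alpha> \<nu> M Z"
    unfolding representer_def using prob Z_M0 moments nu_eq by simp

  \<comment> \<open>M has a density with respect to \<nu>, so S has full M-measure, and
    \<open>Z f\<close> lies on the scaling orbit of f. The same M and Z serve for every such
    S.\<close>
  have "AE f in M. Z f \<in> S"
    if S: "S \<in> sets path_borel" "\<forall>r\<in>pos_orthant. \<forall>f\<in>S. r \<odot> f \<in> S" "emeasure \<nu> (paths - S) = 0" for S
  proof -
    have "AE f in \<nu>. f \<in> S"
      using S(1,3) AE_iff_measurable[of "paths - S" \<nu> "\<lambda>f. f \<in> S"]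
        sets.compl_sets[OF S(1)] by auto
    then have "AE f in restrict_space \<nu> paths0. f \<in> S"
      by (subst AE_restrict_space_iff[OF paths0_space]) auto
    then have "AE f in M. f \<in> S"
      unfolding M_def using measurable_restrict_space1[of \<phi> \<nu> borel paths0]
      by (subst AE_density) auto
    then show ?thesis
    proof (rule AE_mp, intro AE_I2 impI)
      fix f assume "f \<in> space M" "f \<in> S"
      then show "Z f \<in> S" using S(2) c_pos by (simp add: Z_def space_M)
    qed
  qed
  with rep show ?thesis by blast
qed

end

section \<open>Pareto scaling\<close>

lemma integral_mono_measure_finite:
  fixes G :: "'a \<Rightarrow> real"
  assumes sets: "sets \<mu> = sets \<eta>" and fin: "finite_measure \<eta>"
    and le: "\<And>B. B \<in> sets \<mu> \<Longrightarrow> emeasure \<mu> B \<le> emeasure \<eta> B"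
    and G: "G \<in> borel_measurable \<mu>" and nonneg: "\<And>x. x \<in> space \<mu> \<Longrightarrow> 0 \<le> G x"
    and bound: "\<And>x. x \<in> space \<mu> \<Longrightarrow> G x \<le> b"
  shows "integral\<^sup>L \<mu> G \<le> integral\<^sup>L \<eta> G"
proof -
  interpret eta: finite_measure \<eta> by fact
  have space: "space \<mu> = space \<eta>" using sets by (rule sets_eq_imp_space_eq)
  have G': "G \<in> borel_measurable \<eta>" using G measurable_cong_sets[OF sets refl] by blast
  have "(\<integral>\<^sup>+ x. ennreal (G x) \<partial>\<mu>) \<le> (\<integral>\<^sup>+ x. ennreal (G x) \<partial>\<eta>)"
    by (intro nn_integral_mono_measure sets) (use le in \<open>simp add: le_measure[OF sets]\<close>)
  \<comment> \<open>Since \<open>enn2real\<close> sends infinity to 0, it preserves the inequality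
    only when the larger integral is finite.\<close>
  moreover have "(\<integral>\<^sup>+ x. ennreal (G x) \<partial>\<eta>) < \<infinity>"
  proof -
    have "(\<integral>\<^sup>+ x. ennreal (G x) \<partial>\<eta>) \<le> (\<integral>\<^sup>+ x. ennreal b \<partial>\<eta>)"
      using bound by (intro nn_integral_mono) (simp add: space ennreal_leI)
    also have "\<dots> < \<infinity>" by (simp add: ennreal_mult_less_top eta.emeasure_eq_measure)
    finally show ?thesis .
  qed
  ultimately show ?thesis
    using nonneg G G' space
    by (subst (1 2) integral_eq_nn_integral) (auto intro!: enn2real_mono AE_I2)
qed

text \<open>Both c + F and c - F are nonnegative, so each has the smaller integral under \<mu>. The
  two inequalities bound the difference from either side by c times the missing mass.\<close>

lemma abs_integral_diff_le:
  fixes F :: "'a \<Rightarrow> real"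
  assumes sets: "sets \<mu> = sets \<eta>" and fin: "finite_measure \<eta>"
    and le: "\<And>B. B \<in> sets \<mu> \<Longrightarrow> emeasure \<mu> B \<le> emeasure \<eta> B"
    and F: "F \<in> borel_measurable \<mu>" and bound: "\<And>x. x \<in> space \<mu> \<Longrightarrow> \<bar>F x\<bar> \<le> c"
  shows "\<bar>integral\<^sup>L \<mu> F - integral\<^sup>L \<eta> F\<bar> \<le> c * (measure \<eta> (space \<eta>) - measure \<mu> (space \<mu>))"
proof -
  interpret eta: finite_measure \<eta> by fact
  have space: "space \<mu> = space \<eta>" using sets by (rule sets_eq_imp_space_eq)
  interpret mu: finite_measure \<mu>
    using le[OF sets.top] eta.emeasure_finite[of "space \<eta>"]
    by (intro finite_measureI) (auto simp: space top_unique)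
  have F': "F \<in> borel_measurable \<eta>" using F measurable_cong_sets[OF sets refl] by blast
  have int: "integrable \<mu> F" "integrable \<eta> F"
    using F F' bound
    by (auto intro!: mu.integrable_const_bound[of _ c] eta.integrable_const_bound[of _ c] AE_I2 simp: space)
  have F_bounds: "0 \<le> c + F x" "c + F x \<le> 2 * c" "0 \<le> c - F x" "c - F x \<le> 2 * c"
    if "x \<in> space \<mu>" for x
    using bound[OF that] by linarith+
  have meas: "(\<lambda>x. c + F x) \<in> borel_measurable \<mu>" "(\<lambda>x. c - F x) \<in> borel_measurable \<mu>"
    using F by simp_all
  have "integral\<^sup>L \<mu> (\<lambda>x. c + F x) \<le> integral\<^sup>L \<eta> (\<lambda>x. c + F x)"
    by (rule integral_mono_measure_finite[OF sets fin le meas(1) F_bounds(1,2)])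
  moreover have "integral\<^sup>L \<mu> (\<lambda>x. c - F x) \<le> integral\<^sup>L \<eta> (\<lambda>x. c - F x)"
    by (rule integral_mono_measure_finite[OF sets fin le meas(2) F_bounds(3,4)])
  ultimately show ?thesis
    using int by (simp add: algebra_simps)
qed

lemma tv_dist_le:
  assumes sets: "sets \<mu> = sets \<eta>" and fin: "finite_measure \<eta>"
    and le: "\<And>B. B \<in> sets \<mu> \<Longrightarrow> emeasure \<mu> B \<le> emeasure \<eta> B"
  shows "0 \<le> tv_dist \<mu> \<eta>" "tv_dist \<mu> \<eta> \<le> measure \<eta> (space \<eta>) - measure \<mu> (space \<mu>)"
proof -
  let ?F = "{F \<in> borel_measurable \<mu>. \<forall>x\<in>space \<mu>. F x \<in> {-1..1::real}}"
  have bound: "\<bar>integral\<^sup>L \<mu> F - integral\<^sup>L \<eta> F\<bar> \<le> measure \<eta> (space \<eta>) - measure \<mu> (space \<mu>)"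
    if "F \<in> ?F" for F
    using abs_integral_diff_le[OF sets fin le, of F 1] that by (auto simp: abs_le_iff minus_le_iff)
  \<comment> \<open>The zero function shows that the class is nonempty, as the upper bound on the
    supremum requires, and also yields the lower bound 0.\<close>
  have zero: "(\<lambda>_. 0) \<in> ?F" by simp
  have "\<bar>integral\<^sup>L \<mu> (\<lambda>_. 0) - integral\<^sup>L \<eta> (\<lambda>_. 0 :: real)\<bar> \<le> tv_dist \<mu> \<eta>"
    unfolding tv_dist_def by (rule cSUP_upper[OF zero]) (use bound in \<open>auto intro!: bdd_aboveI2\<close>)
  then show "0 \<le> tv_dist \<mu> \<eta>" by simp
  show "tv_dist \<mu> \<eta> \<le> measure \<eta> (space \<eta>) - measure \<mu> (space \<mu>)"
    unfolding tv_dist_def using zero bound by (intro cSUP_least) blast+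
qed

section \<open>The joint limit in u and the Pareto law\<close>

lemma eventually_all_at_top:
  fixes c :: real
  shows "eventually (\<lambda>u :: real ^ 'q. \<forall>i. c \<le> u $ i) all_at_top"
  unfolding all_at_top_def eventually_filtercomap_at_top_linorder
  by (intro exI[of _ c]) (auto simp: Min_ge_iff)

lemma eventually_pos_orthant: "eventually (\<lambda>u :: real ^ 'q. u \<in> pos_orthant) all_at_top"
proof (rule eventually_mono[OF eventually_all_at_top[of 1]])
  fix u :: "real ^ 'q" assume "\<forall>i. 1 \<le> u $ i"
  then have "0 < u $ i" for i using zero_less_one by (meson less_le_trans)
  then show "u \<in> pos_orthant" by (simp add: pos_orthant_def)
qed

text \<open>The strict inequality \<open>1 < r\<^sub>i\<close> describes the same law as \<open>1 \<le> r\<^sub>i\<close> and matches the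
  orthants that generate the Borel sets.\<close>

lemma distr_pareto:
  fixes R :: "'w \<Rightarrow> real ^ 'q"
  assumes alpha: "\<forall>i. 0 < \<alpha> $ i" and prob: "prob_space M" and pareto: "independent_pareto \<alpha> M R Z"
  shows "distr M borel R = density (theta \<alpha>) (indicator {r. \<forall>i. 1 < r $ i})"
proof (rule measure_eqI_orthant)
  interpret prob_space M by (rule prob)
  have R [measurable]: "R \<in> borel_measurable M"
    and indep: "indep_vars (\<lambda>_. borel) (\<lambda>i \<omega>. R \<omega> $ i) UNIV"
    and tail: "\<And>i x. 1 \<le> x \<Longrightarrow> prob {\<omega> \<in> space M. x < R \<omega> $ i} = x powr (- \<alpha> $ i)"
    using pareto unfolding independent_pareto_def by auto
  fix x :: "real ^ 'q"
  \<comment> \<open>Both laws live on the orthant with corner (1,...,1), so a threshold below 1 acts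
    like 1. The cut also makes the thresholds positive, as \<open>emeasure_theta_orthant\<close>
    requires.\<close>
  let ?y = "\<chi> i. max (x $ i) 1"
  have prob_tail: "prob {\<omega> \<in> space M. x $ i < R \<omega> $ i} = ?y $ i powr (- \<alpha> $ i)" for i
  proof (cases "1 \<le> x $ i")
    case False
    have "prob {\<omega> \<in> space M. 1 < R \<omega> $ i} \<le> prob {\<omega> \<in> space M. x $ i < R \<omega> $ i}"
      using False by (intro finite_measure_mono) auto
    then have "prob {\<omega> \<in> space M. x $ i < R \<omega> $ i} = 1" using tail[of 1 i] by (simp add: order_antisym)
    then show ?thesis using False by (simp add: max_def)
  qed (simp add: tail max_def)
  have "emeasure (distr M borel R) {r. \<forall>i. x $ i < r $ i} = prob {\<omega> \<in> space M. \<forall>i. x $ i < R \<omega> $ i}"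
    by (simp add: emeasure_distr emeasure_eq_measure vimage_def Int_def conj_commute)
  also have "{\<omega> \<in> space M. \<forall>i. x $ i < R \<omega> $ i} =
      (\<Inter>i\<in>UNIV. (\<lambda>\<omega>. R \<omega> $ i) -` {x $ i<..} \<inter> space M)" by auto
  also have "prob \<dots> = (\<Prod>i\<in>UNIV. prob ((\<lambda>\<omega>. R \<omega> $ i) -` {x $ i<..} \<inter> space M))"
    by (rule indep_varsD[OF indep]) auto
  also have "\<dots> = (\<Prod>i\<in>UNIV. ?y $ i powr (- \<alpha> $ i))"
    using prob_tail by (simp add: vimage_def Int_def conj_commute)
  finally have lhs: "emeasure (distr M borel R) {r. \<forall>i. x $ i < r $ i} =
    ennreal (\<Prod>i\<in>UNIV. ?y $ i powr (- \<alpha> $ i))" .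
  have "emeasure (density (theta \<alpha>) (indicator {r. \<forall>i. 1 < r $ i})) {r. \<forall>i. x $ i < r $ i} =
      emeasure (theta \<alpha>) ({r. \<forall>i. 1 < r $ i} \<inter> {r. \<forall>i. x $ i < r $ i})"
    by (subst emeasure_density)
      (simp_all add: indicator_inter_arith[symmetric] flip: nn_integral_indicator)
  also have "{r. \<forall>i. 1 < r $ i} \<inter> {r. \<forall>i. x $ i < r $ i} = {r. \<forall>i. ?y $ i < r $ i}" by auto
  also have "emeasure (theta \<alpha>) \<dots> = ennreal (\<Prod>i\<in>UNIV. ?y $ i powr (- \<alpha> $ i))"
    by (rule emeasure_theta_orthant[OF alpha]) (simp add: pos_orthant_def less_max_iff_disj)
  finally show "emeasure (distr M borel R) {r. \<forall>i. x $ i < r $ i} =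
      emeasure (density (theta \<alpha>) (indicator {r. \<forall>i. 1 < r $ i})) {r. \<forall>i. x $ i < r $ i}"
    using lhs by simp
  show "emeasure (distr M borel R) {r. \<forall>i. x $ i < r $ i} \<noteq> \<infinity>" unfolding lhs by simp
qed simp_all

text \<open>Independence of the generated sigma-fields is the product formula on rectangles, and
  rectangles determine a product of sigma-finite measures.\<close>

lemma distr_pair_pareto:
  fixes Z :: "'w \<Rightarrow> 't::topological_space \<Rightarrow> real ^ 'q"
  assumes prob: "prob_space M" and paths0: "paths0 \<in> sets (path_borel :: ('t \<Rightarrow> real ^ 'q) measure)"
    and Z: "Z \<in> M \<rightarrow>\<^sub>M path0_borel" and pareto: "independent_pareto \<alpha> M R Z"
  shows "distr M path_borel Z \<Otimes>\<^sub>M distr M borel R = distr M (path_borel \<Otimes>\<^sub>M borel) (\<lambda>\<omega>. (Z \<omega>, R \<omega>))"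
proof (rule pair_measure_eqI)
  interpret prob_space M by (rule prob)
  have R [measurable]: "R \<in> borel_measurable M"
    and indep: "indep_set {R -` B \<inter> space M |B. B \<in> sets borel}
       {Z -` A \<inter> space M |A. A \<in> sets path0_borel}"
    using pareto unfolding independent_pareto_def by auto
  have Z' [measurable]: "Z \<in> M \<rightarrow>\<^sub>M path_borel"
    using Z by (rule measurable_restrict_space2_iff[THEN iffD1, THEN conjunct1])
  show "sigma_finite_measure (distr M path_borel Z)" "sigma_finite_measure (distr M borel R)"
    using Z' R by (simp_all add: prob_space_distr prob_space_imp_sigma_finite)
  fix A B assume "A \<in> sets (distr M path_borel Z)" "B \<in> sets (distr M borel R)"
  then have [measurable]: "A \<in> sets path_borel" "B \<in> sets borel" by simp_all
  \<comment> \<open>Independence is stated for the trace sigma-field on \<open>paths0\<close>. As Z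
    stays in \<open>paths0\<close>, intersecting A with it leaves the event unchanged.\<close>
  have ZA: "Z -` A \<inter> space M = Z -` (A \<inter> paths0) \<inter> space M"
    using measurable_space[OF Z] by (auto simp: space_restrict_space)
  have A0: "A \<inter> paths0 \<in> sets path0_borel"
    using paths0 by (auto simp: sets_restrict_space)
  have "prob ((R -` B \<inter> space M) \<inter> (Z -` A \<inter> space M)) =
      prob (R -` B \<inter> space M) * prob (Z -` A \<inter> space M)"
    unfolding ZA using A0 \<open>B \<in> sets borel\<close> by (intro indep_setD[OF indep]) blast+
  moreover have "(\<lambda>\<omega>. (Z \<omega>, R \<omega>)) -` (A \<times> B) \<inter> space M = (R -` B \<inter> space M) \<inter> (Z -` A \<inter> space M)"
    by auto
  ultimately show "emeasure (distr M path_borel Z) A * emeasure (distr M borel R) B =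
      emeasure (distr M (path_borel \<Otimes>\<^sub>M borel) (\<lambda>\<omega>. (Z \<omega>, R \<omega>))) (A \<times> B)"
    by (simp add: emeasure_distr emeasure_eq_measure ennreal_mult[symmetric] mult.commute)
qed simp

section \<open>Rescaled Pareto multiples expressed through a fixed product measure\<close>

context index_exhaustion
begin

text \<open>Substituting r = u*s lets the homogeneity of \<open>theta\<close> absorb the
  normalisation. All dependence on u then sits in the constraint on s, so domination and convergence
  become comparisons of sets.\<close>

lemma emeasure_scaled_pareto:
  fixes \<alpha> u :: "real ^ 'q" and Z :: "'w \<Rightarrow> 't \<Rightarrow> real ^ 'q"
  assumes alpha: "\<forall>i. 0 < \<alpha> $ i" and prob: "prob_space M"
    and Z: "Z \<in> M \<rightarrow>\<^sub>M path0_borel" and pareto: "independent_pareto \<alpha> M R Z"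
    and u: "u \<in> pos_orthant" and A [measurable]: "A \<in> sets path_borel"
  shows "ennreal (chi_pow \<alpha> u) *
      emeasure (distr M path_borel (\<lambda>\<omega>. vec_inverse u \<odot> R \<omega> \<odot> Z \<omega>)) A =
    emeasure (M \<Otimes>\<^sub>M theta \<alpha>)
      {p \<in> space (M \<Otimes>\<^sub>M theta \<alpha>). snd p \<odot> Z (fst p) \<in> A \<and> (\<forall>i. 1 < u $ i * snd p $ i)}"
proof -
  interpret prob_space M by (rule prob)
  interpret theta: sigma_finite_measure "theta \<alpha>" by (rule sigma_finite_theta[OF alpha])
  have R [measurable]: "R \<in> borel_measurable M"
    using pareto unfolding independent_pareto_def by auto
  have Z' [measurable]: "Z \<in> M \<rightarrow>\<^sub>M path_borel"
    using Z by (rule measurable_restrict_space2_iff[THEN iffD1, THEN conjunct1])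
  interpret R: prob_space "distr M borel R" by (rule prob_space_distr) simp
  let ?T = "\<lambda>r z. vec_inverse u \<odot> r \<odot> z"
  let ?big = "{r :: real ^ 'q. \<forall>i. 1 < r $ i}"
  let ?E = "{p \<in> space (M \<Otimes>\<^sub>M theta \<alpha>). snd p \<odot> Z (fst p) \<in> A \<and> (\<forall>i. 1 < u $ i * snd p $ i)}"
  have "?big \<in> sets borel" by measurable
  then have [measurable]: "indicator ?big \<in> borel_measurable (borel :: (real ^ 'q) measure)" by simp
  have "emeasure (distr M path_borel (\<lambda>\<omega>. vec_inverse u \<odot> R \<omega> \<odot> Z \<omega>)) A =
      (\<integral>\<^sup>+ \<omega>. indicator A (?T (R \<omega>) (Z \<omega>)) \<partial>M)"
    by (simp add: nn_integral_indicator[symmetric] nn_integral_distr del: nn_integral_indicator)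
  also have "\<dots> = (\<integral>\<^sup>+ p. indicator A (?T (snd p) (fst p)) \<partial>distr M (path_borel \<Otimes>\<^sub>M borel) (\<lambda>\<omega>. (Z \<omega>, R \<omega>)))"
    by (simp add: nn_integral_distr)
  also have "\<dots> = (\<integral>\<^sup>+ z. \<integral>\<^sup>+ r. indicator A (?T r z) \<partial>distr M borel R \<partial>distr M path_borel Z)"
    unfolding distr_pair_pareto[OF prob sets_paths0 Z pareto, symmetric]
    by (subst R.nn_integral_fst[symmetric]) simp_all
  also have "\<dots> = (\<integral>\<^sup>+ \<omega>. \<integral>\<^sup>+ r. indicator A (?T r (Z \<omega>)) \<partial>distr M borel R \<partial>M)"
    by (simp add: nn_integral_distr)
  also have "\<dots> = (\<integral>\<^sup>+ \<omega>. \<integral>\<^sup>+ r. indicator ?big r * indicator A (?T r (Z \<omega>)) \<partial>theta \<alpha> \<partial>M)"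
    unfolding distr_pareto[OF alpha prob pareto]
    by (intro nn_integral_cong) (simp add: nn_integral_density)
  finally have "ennreal (chi_pow \<alpha> u) *
        emeasure (distr M path_borel (\<lambda>\<omega>. vec_inverse u \<odot> R \<omega> \<odot> Z \<omega>)) A =
      (\<integral>\<^sup>+ \<omega>. ennreal (chi_pow \<alpha> u) *
        (\<integral>\<^sup>+ r. indicator ?big r * indicator A (?T r (Z \<omega>)) \<partial>theta \<alpha>) \<partial>M)"
    by (simp add: nn_integral_cmult)
  also have "\<dots> = (\<integral>\<^sup>+ \<omega>. \<integral>\<^sup>+ s. indicator ?E (\<omega>, s) \<partial>theta \<alpha> \<partial>M)"
  proof (rule nn_integral_cong)
    fix \<omega> assume \<omega>: "\<omega> \<in> space M"
    have "(\<lambda>r. ?T r (Z \<omega>)) \<in> borel \<rightarrow>\<^sub>M path_borel"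
      by (intro measurable_odot' measurable_const measurable_ident_sets measurable_space[OF Z' \<omega>]) simp_all
    then have "(\<lambda>r. indicator ?big r * indicator A (?T r (Z \<omega>)) :: ennreal) \<in> borel_measurable borel"
      by measurable
    note meas = this
    let ?us = "\<lambda>s :: real ^ 'q. \<chi> i. u $ i * s $ i"
    have "ennreal (chi_pow \<alpha> u) * (\<integral>\<^sup>+ r. indicator ?big r * indicator A (?T r (Z \<omega>)) \<partial>theta \<alpha>) =
        (\<integral>\<^sup>+ s. indicator ?big (?us s) * indicator A (?T (?us s) (Z \<omega>)) \<partial>theta \<alpha>)"
      by (rule nn_integral_theta_scale[OF u alpha meas, symmetric])
    also have "\<dots> = (\<integral>\<^sup>+ s. indicator ?E (\<omega>, s) \<partial>theta \<alpha>)"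
    proof (rule nn_integral_cong)
      fix s :: "real ^ 'q"
      have "?T (?us s) (Z \<omega>) = s \<odot> Z \<omega>"
        unfolding odot_odot[of u s, symmetric] by (simp add: vec_inverse_odot_cancel[OF u])
      then show "indicator ?big (?us s) * indicator A (?T (?us s) (Z \<omega>)) = (indicator ?E (\<omega>, s) :: ennreal)"
        using \<omega> by (auto simp: indicator_def space_pair_measure)
    qed
    finally show "ennreal (chi_pow \<alpha> u) *
        (\<integral>\<^sup>+ r. indicator ?big r * indicator A (?T r (Z \<omega>)) \<partial>theta \<alpha>) =
      (\<integral>\<^sup>+ s. indicator ?E (\<omega>, s) \<partial>theta \<alpha>)" .
  qed
  also have "\<dots> = emeasure (M \<Otimes>\<^sub>M theta \<alpha>) ?E"
  proof (rule theta.emeasure_pair_measure[symmetric])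
    show "?E \<in> sets (M \<Otimes>\<^sub>M theta \<alpha>)" by measurable
  qed
  finally show ?thesis .
qed

end

section \<open>Domination and limits for a given representer\<close>

context tail_measure
begin

context
  fixes M :: "'w measure" and Z :: "'w \<Rightarrow> 't \<Rightarrow> real ^ 'q" and R :: "'w \<Rightarrow> real ^ 'q"
  assumes representer: "representer K \<alpha> \<nu> M Z" and pareto: "independent_pareto \<alpha> M R Z"
begin

lemma prob_space_M: "prob_space M" and Z_paths0: "Z \<in> M \<rightarrow>\<^sub>M path0_borel" and nu_eq: "\<nu> = nu_of \<alpha> M Z"
  using representer by (auto simp: representer_def)

lemma Z_measurable [measurable]: "Z \<in> M \<rightarrow>\<^sub>M path_borel"
  using Z_paths0 by (rule measurable_restrict_space2_iff[THEN iffD1, THEN conjunct1])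

lemma R_measurable [measurable]: "R \<in> borel_measurable M"
  using pareto unfolding independent_pareto_def by auto

lemma emeasure_nu:
  assumes [measurable]: "A \<in> sets path_borel"
  shows "emeasure \<nu> A =
    emeasure (M \<Otimes>\<^sub>M theta \<alpha>) {p \<in> space (M \<Otimes>\<^sub>M theta \<alpha>). snd p \<odot> Z (fst p) \<in> A}"
  unfolding nu_eq nu_of_eq_distr[OF alpha Z_measurable]
  by (subst emeasure_distr) (auto intro!: arg_cong[where f = "emeasure (M \<Otimes>\<^sub>M theta \<alpha>)"] simp: split_beta)

lemma emeasure_mu:
  assumes "u \<in> pos_orthant" and A: "A \<in> sets path_borel" "A \<subseteq> paths0"
  shows "emeasure (mu \<alpha> M (\<lambda>\<omega>. R \<omega> \<odot> Z \<omega>) u) A = emeasure (M \<Otimes>\<^sub>M theta \<alpha>)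
    {p \<in> space (M \<Otimes>\<^sub>M theta \<alpha>). snd p \<odot> Z (fst p) \<in> A \<and> (\<forall>i. 1 < u $ i * snd p $ i)}"
  unfolding mu_def emeasure_scaled_pareto[OF alpha prob_space_M Z_paths0 pareto assms(1) A(1), symmetric]
  using sets_paths0 A(2) by (subst emeasure_restrict_space) (simp_all add: sets.Int_space_eq2)

lemma sets_mu: "sets (mu \<alpha> M (\<lambda>\<omega>. R \<omega> \<odot> Z \<omega>) u) = sets path0_borel"
  unfolding mu_def by (simp add: sets_restrict_space)

lemma space_mu: "space (mu \<alpha> M (\<lambda>\<omega>. R \<omega> \<odot> Z \<omega>) u) = paths0"
  using sets_eq_imp_space_eq[OF sets_mu] by (simp add: space_restrict_space paths0_def Int_absorb2)

lemma sets_mu_iff: "A \<in> sets (mu \<alpha> M (\<lambda>\<omega>. R \<omega> \<odot> Z \<omega>) u) \<longleftrightarrow> A \<subseteq> paths0 \<and> A \<in> sets path_borel"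
  unfolding sets_mu by (rule sets_restrict_space_iff[OF sets_paths0_Int_space])

lemma mu_le:
  assumes "u \<in> pos_orthant" and A [measurable]: "A \<in> sets path_borel" and "A \<subseteq> paths0"
  shows "emeasure (mu \<alpha> M (\<lambda>\<omega>. R \<omega> \<odot> Z \<omega>) u) A \<le> emeasure \<nu> A"
proof -
  have "{p \<in> space (M \<Otimes>\<^sub>M theta \<alpha>). snd p \<odot> Z (fst p) \<in> A} \<in> sets (M \<Otimes>\<^sub>M theta \<alpha>)" by measurable
  then show ?thesis
    unfolding emeasure_mu[OF assms] emeasure_nu[OF A] by (intro emeasure_mono) blast+
qed

text \<open>Once every coordinate of u is at least k + 1, the mass of A lies between that of
  \<open>G k\<close> and its \<nu>-mass. Only the smallest coordinate matters, so the relative rates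
  are irrelevant.\<close>

lemma measure_mu_tendsto:
  assumes A [measurable]: "A \<in> sets path_borel" "A \<subseteq> paths0" and fin: "emeasure \<nu> A < \<infinity>"
  shows "((\<lambda>u. measure \<nu> A - measure (mu \<alpha> M (\<lambda>\<omega>. R \<omega> \<odot> Z \<omega>) u) A) \<longlongrightarrow> 0) all_at_top"
proof -
  let ?N = "M \<Otimes>\<^sub>M theta \<alpha>"
  interpret M: prob_space M by (rule prob_space_M)
  interpret theta: sigma_finite_measure "theta \<alpha>" by (rule sigma_finite_theta[OF alpha])
  interpret pair: pair_sigma_finite M "theta \<alpha>" ..
  let ?E = "{p \<in> space ?N. snd p \<odot> Z (fst p) \<in> A}"
  \<comment> \<open>The constraint region for u with all coordinates equal to \<open>Suc k\<close>;
    it reduces the limit in u to an increasing sequence of sets.\<close>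
  define G where "G k = {p \<in> space ?N. snd p \<odot> Z (fst p) \<in> A \<and> (\<forall>i. 1 < real (Suc k) * snd p $ i)}" for k
  have G [measurable]: "G k \<in> sets ?N" for k unfolding G_def by measurable
  have E [measurable]: "?E \<in> sets ?N" by measurable
  have inc: "incseq G"
  proof (rule incseq_SucI, rule subsetI)
    fix k p assume p: "p \<in> G k"
    have "1 < real (Suc (Suc k)) * snd p $ i" for i
    proof -
      have "1 < real (Suc k) * snd p $ i" using p by (simp add: G_def)
      moreover from this have "0 < snd p $ i" by (smt (verit) mult_nonneg_nonpos of_nat_0_le_iff)
      ultimately show ?thesis by (simp add: algebra_simps)
    qed
    with p show "p \<in> G (Suc k)" by (simp add: G_def)
  qed
  \<comment> \<open>The union of the sets \<open>G k\<close> misses exactly the pairs in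
    \<open>?E\<close> with some nonpositive scale, and \<open>theta\<close> gives these no
    mass.\<close>
  have "AE p in ?N. snd p \<in> pos_orthant"
  proof (rule pair.AE_pair_measure)
    show "{p \<in> space ?N. snd p \<in> pos_orthant} \<in> sets ?N" by measurable
  qed (use AE_theta_pos_orthant[OF alpha] in simp)
  then have "emeasure ?N (\<Union>k. G k) = emeasure ?N ?E"
  proof (intro emeasure_eq_AE, elim AE_mp, intro AE_I2 impI)
    fix p assume p: "p \<in> space ?N" "snd p \<in> pos_orthant"
    have "\<exists>k. \<forall>i. 1 < real (Suc k) * snd p $ i"
    proof -
      have "\<forall>i. \<exists>k. inverse (real (Suc k)) < snd p $ i"
        using p(2) reals_Archimedean unfolding pos_orthant_def by blast
      then obtain k where k: "\<And>i. inverse (real (Suc (k i))) < snd p $ i" by metis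
      have "1 < real (Suc (Max (range k))) * snd p $ i" for i
      proof -
        have "inverse (real (Suc (Max (range k)))) \<le> inverse (real (Suc (k i)))" by simp
        then have "inverse (real (Suc (Max (range k)))) < snd p $ i" using k[of i] by linarith
        then show ?thesis by (simp add: inverse_eq_divide divide_less_eq mult.commute)
      qed
      then show ?thesis by blast
    qed
    then show "p \<in> (\<Union>k. G k) \<longleftrightarrow> p \<in> ?E" using p(1) by (auto simp: G_def)
  next
    show "(\<Union>k. G k) \<in> sets ?N" "?E \<in> sets ?N" by measurable
  qed
  then have lim: "emeasure ?N (\<Union>k. G k) = emeasure \<nu> A" unfolding emeasure_nu[OF A(1)] .
  have "range G \<subseteq> sets ?N" using G by (rule image_subsetI)
  then have "(\<lambda>k. measure ?N (G k)) \<longlonglongrightarrow> measure ?N (\<Union>k. G k)"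
    by (rule Lim_measure_incseq[OF _ inc]) (use lim fin in simp)
  then have conv: "(\<lambda>k. measure ?N (G k)) \<longlonglongrightarrow> measure \<nu> A"
    unfolding measure_def lim .
  show ?thesis
  proof (rule tendstoI)
    fix e :: real assume "0 < e"
    then have "eventually (\<lambda>k. dist (measure ?N (G k)) (measure \<nu> A) < e) sequentially"
      by (rule tendstoD[OF conv])
    then obtain k where k: "\<bar>measure ?N (G k) - measure \<nu> A\<bar> < e"
      by (auto simp: eventually_sequentially dist_real_def)
    show "eventually (\<lambda>u. dist (measure \<nu> A - measure (mu \<alpha> M (\<lambda>\<omega>. R \<omega> \<odot> Z \<omega>) u) A) 0 < e) all_at_top"
    proof (rule eventually_mono[OF eventually_all_at_top[of "real (Suc k)"]])
      fix u :: "real ^ 'q" assume u: "\<forall>i. real (Suc k) \<le> u $ i"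
      then have u_pos: "u \<in> pos_orthant"
        unfolding pos_orthant_def by (auto intro: less_le_trans[of 0 "real (Suc k)"])
      have le: "emeasure (mu \<alpha> M (\<lambda>\<omega>. R \<omega> \<odot> Z \<omega>) u) A \<le> emeasure \<nu> A"
        by (rule mu_le[OF u_pos A])
      have "G k \<subseteq> {p \<in> space ?N. snd p \<odot> Z (fst p) \<in> A \<and> (\<forall>i. 1 < u $ i * snd p $ i)}"
      proof
        fix p assume p: "p \<in> G k"
        have "1 < u $ i * snd p $ i" for i
        proof -
          have *: "1 < real (Suc k) * snd p $ i" using p by (simp add: G_def)
          then have "0 < snd p $ i" by (smt (verit) mult_nonneg_nonpos of_nat_0_le_iff)
          then have "real (Suc k) * snd p $ i \<le> u $ i * snd p $ i" using u by (intro mult_right_mono) auto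
          with * show ?thesis by linarith
        qed
        with p show "p \<in> {p \<in> space ?N. snd p \<odot> Z (fst p) \<in> A \<and> (\<forall>i. 1 < u $ i * snd p $ i)}"
          by (simp add: G_def)
      qed
      then have ge: "emeasure ?N (G k) \<le> emeasure (mu \<alpha> M (\<lambda>\<omega>. R \<omega> \<odot> Z \<omega>) u) A"
        unfolding emeasure_mu[OF u_pos A] by (rule emeasure_mono) measurable
      have "measure (mu \<alpha> M (\<lambda>\<omega>. R \<omega> \<odot> Z \<omega>) u) A \<le> measure \<nu> A"
        "measure ?N (G k) \<le> measure (mu \<alpha> M (\<lambda>\<omega>. R \<omega> \<odot> Z \<omega>) u) A"
        unfolding measure_def using le ge fin by (auto intro!: enn2real_mono)
      with k show "dist (measure \<nu> A - measure (mu \<alpha> M (\<lambda>\<omega>. R \<omega> \<odot> Z \<omega>) u) A) 0 < e"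
        by (simp add: dist_real_def)
    qed
  qed
qed

text \<open>\<open>mu\<close> lives on \<open>paths0\<close> and \<nu> on \<open>paths\<close>;
  restricted to a subset of \<open>paths0\<close> they share a sigma-field. The four facts are what
  the bound by missing mass needs.\<close>

lemma restricted_mu:
  assumes u: "u \<in> pos_orthant" and A: "A \<in> sets path_borel" "A \<subseteq> paths0" and fin: "emeasure \<nu> A < \<infinity>"
  defines "\<mu> \<equiv> restrict_space (mu \<alpha> M (\<lambda>\<omega>. R \<omega> \<odot> Z \<omega>) u) A" and "\<eta> \<equiv> restrict_space \<nu> A"
  shows "sets \<mu> = sets \<eta>" "finite_measure \<eta>"
    "\<And>B. B \<in> sets \<mu> \<Longrightarrow> emeasure \<mu> B \<le> emeasure \<eta> B"
    "measure \<eta> (space \<eta>) - measure \<mu> (space \<mu>) =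
      measure \<nu> A - measure (mu \<alpha> M (\<lambda>\<omega>. R \<omega> \<odot> Z \<omega>) u) A"
proof -
  let ?mu = "mu \<alpha> M (\<lambda>\<omega>. R \<omega> \<odot> Z \<omega>) u"
  have A_path: "A \<subseteq> paths" using A(2) by (auto simp: paths0_def)
  have A0: "A \<inter> space ?mu \<in> sets ?mu"
    using A by (simp add: space_mu sets_mu_iff Int_absorb2)
  have A1: "A \<inter> space \<nu> \<in> sets \<nu>" using A(1) A_path by (simp add: Int_absorb2)
  have spaces: "space \<mu> = A" "space \<eta> = A"
    using A_path A(2) unfolding \<mu>_def \<eta>_def by (auto simp: space_restrict_space space_mu)
  show sets: "sets \<mu> = sets \<eta>"
    unfolding \<mu>_def \<eta>_def using A(2)
    by (auto simp: set_eq_iff sets_restrict_space_iff[OF A0] sets_restrict_space_iff[OF A1] sets_mu_iff)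
  show "finite_measure \<eta>"
    using fin unfolding \<eta>_def
    by (intro finite_measureI) (simp add: spaces(2)[unfolded \<eta>_def] emeasure_restrict_space[OF A1])
  show "measure \<eta> (space \<eta>) - measure \<mu> (space \<mu>) =
      measure \<nu> A - measure (mu \<alpha> M (\<lambda>\<omega>. R \<omega> \<odot> Z \<omega>) u) A"
    unfolding spaces unfolding \<mu>_def \<eta>_def
    by (simp add: measure_restrict_space[OF A0] measure_restrict_space[OF A1])
  fix B assume "B \<in> sets \<mu>"
  then have B: "B \<subseteq> A" "B \<in> sets path_borel"
    unfolding sets \<eta>_def using A1 by (auto simp: sets_restrict_space_iff)
  show "emeasure \<mu> B \<le> emeasure \<eta> B"
    unfolding \<mu>_def \<eta>_def using B A(2)
    by (simp add: emeasure_restrict_space[OF A0] emeasure_restrict_space[OF A1] mu_le[OF u])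
qed

text \<open>A inherits finite \<nu>-mass from the window containing it, and the distance is then
  squeezed between 0 and the missing mass.\<close>

lemma tv_dist_tendsto:
  assumes "A \<in> B_Pi K"
  shows "((\<lambda>u. tv_dist (restrict_space (mu \<alpha> M (\<lambda>\<omega>. R \<omega> \<odot> Z \<omega>) u) A) (restrict_space \<nu> A)) \<longlongrightarrow> 0)
    all_at_top"
proof -
  obtain n \<epsilon> where A: "A \<in> sets path_borel" "A \<subseteq> paths0"
    and n: "n \<in> pos_indices" "\<epsilon> \<in> pos_orthant" "A \<subseteq> window K n \<epsilon>"
    using assms by (auto simp: B_Pi_def)
  have "emeasure \<nu> A \<le> emeasure \<nu> (window K n \<epsilon>)"
    using n(3) sets_window[OF n(1)] by (intro emeasure_mono) simp_all
  then have fin: "emeasure \<nu> A < \<infinity>" using window_finite[OF n(1,2)] by (rule le_less_trans)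
  show ?thesis
    by (rule tendsto_sandwich[OF _ _ tendsto_const measure_mu_tendsto[OF A fin]];
        rule eventually_mono[OF eventually_pos_orthant])
      (use tv_dist_le[OF restricted_mu(1-3)[OF _ A fin]] in
        \<open>simp_all only: restricted_mu(4)[OF _ A fin]\<close>)
qed

text \<open>The test function vanishes off a window, so both integrals reduce to that window, where
  they differ by at most the bound of F times the missing mass.\<close>

lemma RV_Pi_scaled_pareto: "RV_Pi K \<alpha> \<nu> M (\<lambda>\<omega>. R \<omega> \<odot> Z \<omega>)"
  unfolding RV_Pi_def
proof (intro conjI ballI allI impI)
  show "(\<lambda>\<omega>. R \<omega> \<odot> Z \<omega>) \<in> M \<rightarrow>\<^sub>M path_borel" by measurable
  show "sets \<nu> = sets path_borel" by simp
  show "emeasure \<nu> (space \<nu>) \<noteq> 0"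
    using tail by (simp add: multihomogeneous_tail_measure_def)
  show "emeasure \<nu> (window K n \<epsilon>) < \<infinity>" if "n \<in> pos_indices" "\<epsilon> \<in> pos_orthant" for n \<epsilon>
    using window_finite[OF that] .
  fix F :: "('t \<Rightarrow> real ^ 'q) \<Rightarrow> real"
  assume cont: "continuous_map path_topology euclideanreal F" and "bounded (F ` paths)"
    and vanish: "\<exists>n\<in>pos_indices. \<exists>\<epsilon>\<in>pos_orthant. \<forall>f\<in>paths - window K n \<epsilon>. F f = 0"
  then obtain b where b: "\<And>f. f \<in> paths \<Longrightarrow> \<bar>F f\<bar> \<le> b"
    unfolding bounded_iff by auto
  obtain n \<epsilon> where n: "n \<in> pos_indices" "\<epsilon> \<in> pos_orthant"
    and zero: "\<And>f. f \<in> paths \<Longrightarrow> f \<notin> window K n \<epsilon> \<Longrightarrow> F f = 0"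
    using vanish by blast
  let ?A = "window K n \<epsilon> :: ('t \<Rightarrow> real ^ 'q) set"
  let ?mu = "mu \<alpha> M (\<lambda>\<omega>. R \<omega> \<odot> Z \<omega>)"
  have [measurable]: "F \<in> borel_measurable path_borel"
  proof (rule borel_measurableI)
    fix S :: "real set" assume "open S"
    then have "openin path_topology {f \<in> topspace path_topology. F f \<in> S}"
      using cont by (simp add: continuous_map_def)
    then show "F -` S \<inter> space path_borel \<in> sets path_borel"
      using openin_path_borel by (simp add: topspace_path_topology vimage_def Int_def conj_commute)
  qed
  have A: "?A \<in> sets path_borel" "emeasure \<nu> ?A < \<infinity>"
    by (rule sets_window[OF n(1)], rule window_finite[OF n])
  \<comment> \<open>Positive thresholds exclude identically vanishing coordinates, so the window
    lies in the space that carries \<open>mu\<close>.\<close>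
  have A0: "?A \<subseteq> paths0"
  proof
    fix f assume f: "f \<in> ?A"
    have "\<exists>t. f t $ i \<noteq> 0" for i
    proof -
      have "0 < rho K (n i) i f"
        using f n(2) unfolding window_def pos_orthant_def by (auto intro: less_trans)
      moreover have "f \<in> paths" "1 \<le> n i" using f n(1) by (auto simp: window_def pos_indices_def)
      ultimately show ?thesis by (auto simp: rho_greater_iff)
    qed
    then show "f \<in> paths0" using f by (auto simp: paths0_def D_Pi_def window_def)
  qed
  have Fnu: "integral\<^sup>L \<nu> F = integral\<^sup>L (restrict_space \<nu> ?A) F"
  proof (subst integral_restrict_space)
    have "?A \<subseteq> paths" by (auto simp: window_def)
    then show "?A \<inter> space \<nu> \<in> sets \<nu>" using A(1) by (simp add: Int_absorb2)
    show "integral\<^sup>L \<nu> F = integral\<^sup>L \<nu> (\<lambda>f. indicator ?A f *\<^sub>R F f)"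
      using zero by (intro Bochner_Integration.integral_cong) (auto simp: indicator_def)
  qed
  have Fmu: "integral\<^sup>L (?mu u) F = integral\<^sup>L (restrict_space (?mu u) ?A) F" for u
  proof (subst integral_restrict_space)
    show "?A \<inter> space (?mu u) \<in> sets (?mu u)"
      using A(1) A0 by (simp add: space_mu sets_mu_iff Int_absorb2)
    show "integral\<^sup>L (?mu u) F = integral\<^sup>L (?mu u) (\<lambda>f. indicator ?A f *\<^sub>R F f)"
      using zero by (intro Bochner_Integration.integral_cong) (auto simp: space_mu indicator_def paths0_def)
  qed
  have "\<bar>integral\<^sup>L (?mu u) F - integral\<^sup>L \<nu> F\<bar> \<le> b * (measure \<nu> ?A - measure (?mu u) ?A)"
    if u: "u \<in> pos_orthant" for u
  proof -
    note r = restricted_mu[OF u A(1) A0 A(2)]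
    have "F \<in> borel_measurable (restrict_space \<nu> ?A)"
      by (intro measurable_restrict_space1) simp
    then have F: "F \<in> borel_measurable (restrict_space (?mu u) ?A)"
      using measurable_cong_sets[OF r(1) refl] by blast
    have "\<bar>integral\<^sup>L (restrict_space (?mu u) ?A) F - integral\<^sup>L (restrict_space \<nu> ?A) F\<bar>
        \<le> b * (measure \<nu> ?A - measure (?mu u) ?A)"
      unfolding r(4)[symmetric]
    proof (rule abs_integral_diff_le[OF r(1,2) _ F])
      show "\<bar>F f\<bar> \<le> b" if "f \<in> space (restrict_space (?mu u) ?A)" for f
        using that b by (auto simp: space_restrict_space window_def)
    qed (rule r(3))
    then show ?thesis unfolding Fnu Fmu .
  qed
  then have "eventually (\<lambda>u. norm (integral\<^sup>L (?mu u) F - integral\<^sup>L \<nu> F) \<le>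
      b * (measure \<nu> ?A - measure (?mu u) ?A)) all_at_top"
    by (intro eventually_mono[OF eventually_pos_orthant]) simp
  moreover have "((\<lambda>u. b * (measure \<nu> ?A - measure (?mu u) ?A)) \<longlongrightarrow> 0) all_at_top"
    using tendsto_mult_left[OF measure_mu_tendsto[OF A(1) A0 A(2)], of b] by simp
  ultimately have "((\<lambda>u. integral\<^sup>L (?mu u) F - integral\<^sup>L \<nu> F) \<longlongrightarrow> 0) all_at_top"
    by (rule Lim_null_comparison)
  then show "((\<lambda>u. integral\<^sup>L (?mu u) F) \<longlongrightarrow> integral\<^sup>L \<nu> F) all_at_top"
    by (rule Lim_null[THEN iffD2])
qed

end

end

theorem proposition3p2:
  fixes K :: "nat \<Rightarrow> 't::topological_space set"
    and \<phi> :: "'t \<Rightarrow> real ^ 'm"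
    and \<alpha> :: "real ^ 'q"
    and \<nu> :: "('t \<Rightarrow> real ^ 'q) measure"
  assumes index: "discrete_index K \<or> euclidean_index \<phi> K"
    and alpha: "\<forall>i. 0 < \<alpha> $ i"
    and tail: "multihomogeneous_tail_measure K \<alpha> \<nu>"
  shows "(\<exists>(M :: ('t \<Rightarrow> real ^ 'q) measure) Z. representer K \<alpha> \<nu> M Z) \<and>
    (\<forall>S\<in>sets path_borel.
       (\<forall>r\<in>pos_orthant. \<forall>f\<in>S. r \<odot> f \<in> S) \<and> emeasure \<nu> (paths - S) = 0 \<longrightarrow>
       (\<exists>(M :: ('t \<Rightarrow> real ^ 'q) measure) Z.
          representer K \<alpha> \<nu> M Z \<and> (AE \<omega> in M. Z \<omega> \<in> S))) \<and>
    (\<forall>(M :: 'w measure) Z R.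
       representer K \<alpha> \<nu> M Z \<and> independent_pareto \<alpha> M R Z \<longrightarrow>
       RV_Pi K \<alpha> (nu_of \<alpha> M Z) M (\<lambda>\<omega>. R \<omega> \<odot> Z \<omega>) \<and>
       (\<forall>A\<in>B_Pi K.
          ((\<lambda>u. tv_dist (restrict_space (mu \<alpha> M (\<lambda>\<omega>. R \<omega> \<odot> Z \<omega>) u) A)
                        (restrict_space \<nu> A)) \<longlongrightarrow> 0) all_at_top))"
proof -
  interpret tail_measure K \<alpha> \<nu>
    using index exhaustion_euclidean_index alpha tail
    by unfold_locales (auto simp: discrete_index_def)
  \<comment> \<open>The pair is fixed before any S is given, so it serves both existence
    claims.\<close>
  obtain M :: "('t \<Rightarrow> real ^ 'q) measure" and Z where MZ: "representer K \<alpha> \<nu> M Z"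
    "\<And>S. S \<in> sets path_borel \<Longrightarrow>
      (\<forall>r\<in>pos_orthant. \<forall>f\<in>S. r \<odot> f \<in> S) \<and> emeasure \<nu> (paths - S) = 0 \<Longrightarrow>
      AE f in M. Z f \<in> S"
    using representer_exists by blast
  show ?thesis
  proof (intro conjI ballI allI impI)
    show "\<exists>(M :: ('t \<Rightarrow> real ^ 'q) measure) Z. representer K \<alpha> \<nu> M Z"
      using MZ(1) by blast
    show "\<exists>(M :: ('t \<Rightarrow> real ^ 'q) measure) Z. representer K \<alpha> \<nu> M Z \<and> (AE \<omega> in M. Z \<omega> \<in> S)"
      if "S \<in> sets path_borel"
        "(\<forall>r\<in>pos_orthant. \<forall>f\<in>S. r \<odot> f \<in> S) \<and> emeasure \<nu> (paths - S) = 0" for S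
      using MZ(1) MZ(2)[OF that] by blast
    fix M :: "'w measure" and Z R
    assume "representer K \<alpha> \<nu> M Z \<and> independent_pareto \<alpha> M R Z"
    then have rep: "representer K \<alpha> \<nu> M Z" "independent_pareto \<alpha> M R Z" by simp_all
    show "RV_Pi K \<alpha> (nu_of \<alpha> M Z) M (\<lambda>\<omega>. R \<omega> \<odot> Z \<omega>)"
      unfolding nu_eq[OF rep, symmetric] by (rule RV_Pi_scaled_pareto[OF rep])
    show "((\<lambda>u. tv_dist (restrict_space (mu \<alpha> M (\<lambda>\<omega>. R \<omega> \<odot> Z \<omega>) u) A) (restrict_space \<nu> A))
        \<longlongrightarrow> 0) all_at_top" if "A \<in> B_Pi K" for A
      by (rule tv_dist_tendsto[OF rep that])
  qed
qed

end
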